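(* Let $F$ be a field of characteristic zero and let $\mathbb M=M_{1,1}(F)$ be the algebra of $2\times 2$ matrices over $F$ with its canonical $\mathbb Z_2$-grading and the transpose superinvolution. For each $n\ge 1$, the $n$-th $*$-codimension of $\mathbb M$ is $$c_n^*(\mathbb M)=2^{n}\left(2\sum_{j=0}^{n}\binom{n}{j}\binom{j}{\lfloor j/2\rfloor}2^{-j}-1\right).$$ In particular, $c_n^*(\mathbb M)\approx 4^n n^{-1/2}$, i.e. there are constants $0<c\le C$ such that $c\,4^n n^{-1/2}\le c_n^*(\mathbb M)\le C\,4^n n^{-1/2}$ for all $n\ge 1$, and $\exp^*(\mathbb M)=4$.
   Context: A superalgebra is an associative $F$-algebra $A=A^{(0)}\oplus A^{(1)}$ with $A^{(i)}A^{(j)}\subseteq A^{(i+j \bmod 2)}$; for homogeneous $a\in A^{(i)}$ write $|a|=i$. A superinvolution on $A$ is a linear map $*:A\to A$ with $(A^{(i)})^*=A^{(i)}$, $(a^* )^*=a$ for all $a$, and $(ab)^*=(-1)^{|a||b|}b^*a^*$ for homogeneous $a,b$. A superalgebra with superinvolution is called a $*$-algebra. Put $(A^{(i)})^{+}=\{a\in A^{(i)}:a^*=a\}$ and $(A^{(i)})^{-}=\{a\in A^{(i)}:a^*=-a\}$. $\mathbb M=M_{1,1}(F)$ is $M_2(F)$ with even part $\mathrm{span}\{e_{11},e_{22}\}$, odd part $\mathrm{span}\{e_{12},e_{21}\}$, and superinvolution $\begin{pmatrix}a&c\\d&b\end{pmatrix}^{*}=\begin{pmatrix}b&-c\\d&a\end{pmatrix}$.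 Thus $(\mathbb M^{(0)})^+=F(e_{11}+e_{22})$, $(\mathbb M^{(0)})^-=F(e_{11}-e_{22})$, $(\mathbb M^{(1)})^+=Fe_{21}$, $(\mathbb M^{(1)})^-=Fe_{12}$. Let $\mathcal F$ be the free associative algebra over $F$ on the non-commuting variables $y_{i,0},z_{i,0},y_{i,1},z_{i,1}$ ($i\ge 1$). An element $f\in\mathcal F$ is a $*$-identity of a $*$-algebra $A$ if $f$ vanishes under every substitution of the variables $y_{i,0},z_{i,0},y_{i,1},z_{i,1}$ by elements of $(A^{(0)})^+,(A^{(0)})^-,(A^{(1)})^+,(A^{(1)})^-$ respectively; $Id^*(A)$ is the set of $*$-identities of $A$. $P_n^*$ is the space of multilinear polynomials of degree $n$: $P_n^*=\mathrm{span}_F\{w_{\sigma(1)}\cdots w_{\sigma(n)}: w_i\in\{y_{i,0},y_{i,1},z_{i,0},z_{i,1}\},\ \sigma\in S_n\}$. The $n$-th $*$-codimension of $A$ is $c_n^*(A)=\dim_F P_n^*/(P_n^*\cap Id^*(A))$. The $*$-exponent $\exp^*(A)$ is the integer $d\ge 0$ for which there exist constants $C_1>0,C_2,t_1,t_2$ with $C_1n^{t_1}d^n\le c_n^*(A)\le C_2n^{t_2}d^n$. *)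

theory Defs
  imports
    "HOL-Analysis.Analysis"
    "HOL-Library.Poly_Mapping"
    "Jordan_Normal_Form.Missing_VectorSpace"
begin

hide_const (open) Module.module VectorSpace.subspace

section \<open>Superalgebras with superinvolution\<close>

text \<open>The underlying set of the algebra is the whole type \<open>'a\<close>; \<open>sa_part A i\<close> is
  the homogeneous component of degree \<open>i\<close>, used only for \<open>i = 0, 1\<close>.
  Algebras, and below the free algebra, are taken with a unit so that the empty word can be
  evaluated; multilinear polynomials of positive degree do not involve it.\<close>

record ('f, 'a) superalg =
  sa_scale :: "'f \<Rightarrow> 'a \<Rightarrow> 'a"
  sa_mult :: "'a \<Rightarrow> 'a \<Rightarrow> 'a"
  sa_one :: 'a
  sa_part :: "nat \<Rightarrow> 'a set"
  sa_star :: "'a \<Rightarrow> 'a"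

locale star_algebra =
  fixes A :: "('f::field, 'a::ab_group_add) superalg"
  assumes vector_space: "vector_space (sa_scale A)"
    and assoc: "sa_mult A (sa_mult A a b) c = sa_mult A a (sa_mult A b c)"
    and distrib_left: "sa_mult A a (b + c) = sa_mult A a b + sa_mult A a c"
    and distrib_right: "sa_mult A (a + b) c = sa_mult A a c + sa_mult A b c"
    and scale_mult_left: "sa_mult A (sa_scale A r a) b = sa_scale A r (sa_mult A a b)"
    and scale_mult_right: "sa_mult A a (sa_scale A r b) = sa_scale A r (sa_mult A a b)"
    and one_left: "sa_mult A (sa_one A) a = a"
    and one_right: "sa_mult A a (sa_one A) = a"
    and subspace_part: "i < 2 \<Longrightarrow> module.subspace (sa_scale A) (sa_part A i)"
    and part_sum: "\<exists>b\<in>sa_part A 0. \<exists>c\<in>sa_part A 1. a = b + c"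
    and part_Int: "sa_part A 0 \<inter> sa_part A 1 = {0}"
    and part_mult: "\<lbrakk>i < 2; j < 2; a \<in> sa_part A i; b \<in> sa_part A j\<rbrakk>
      \<Longrightarrow> sa_mult A a b \<in> sa_part A ((i + j) mod 2)"
    and star_linear: "Vector_Spaces.linear (sa_scale A) (sa_scale A) (sa_star A)"
    and star_part: "i < 2 \<Longrightarrow> sa_star A ` sa_part A i = sa_part A i"
    and star_star: "sa_star A (sa_star A a) = a"
    and star_mult: "\<lbrakk>i < 2; j < 2; a \<in> sa_part A i; b \<in> sa_part A j\<rbrakk>
      \<Longrightarrow> sa_star A (sa_mult A a b) =
            sa_scale A ((-1) ^ (i * j)) (sa_mult A (sa_star A b) (sa_star A a))"

definition sym_part :: "('f, 'a) superalg \<Rightarrow> nat \<Rightarrow> 'a set" where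
  "sym_part A i = {a \<in> sa_part A i. sa_star A a = a}"

definition skew_part :: "('f, 'a::uminus) superalg \<Rightarrow> nat \<Rightarrow> 'a set" where
  "skew_part A i = {a \<in> sa_part A i. sa_star A a = - a}"


section \<open>The superalgebra of two by two matrices with the transpose superinvolution\<close>

text \<open>On \<^typ>\<open>'f ^ 2 ^ 2\<close> the class operation \<open>(*)\<close> is componentwise; the matrix
  product is \<open>(**)\<close>.\<close>

definition M11 :: "('f::field, 'f ^ 2 ^ 2) superalg" where
  "M11 = \<lparr> sa_scale = (\<lambda>r X. \<chi> i j. r * X $ i $ j),
           sa_mult = (**),
           sa_one = mat 1,
           sa_part = (\<lambda>d. if d = 0 then {X. X $ 1 $ 2 = 0 \<and> X $ 2 $ 1 = 0}
                               else {X. X $ 1 $ 1 = 0 \<and> X $ 2 $ 2 = 0}),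
           sa_star = (\<lambda>X. vector [vector [X $ 2 $ 2, - X $ 1 $ 2],
                                  vector [X $ 2 $ 1, X $ 1 $ 1]]) \<rparr>"

lemma star_algebra_M11: "star_algebra (M11 :: ('f::field, 'f ^ 2 ^ 2) superalg)"
proof -
  let ?M = "M11 :: ('f, 'f ^ 2 ^ 2) superalg"
  have vs: "vector_space (sa_scale ?M)"
    by unfold_locales (simp_all add: M11_def vec_eq_iff algebra_simps)
  have md: "Modules.module (sa_scale ?M)"
    using vs by (simp add: module_iff_vector_space)
  have lt2: "i < 2 \<longleftrightarrow> i = 0 \<or> i = Suc 0" for i :: nat
    by auto
  have star_star: "sa_star ?M (sa_star ?M a) = a" for a
    by (simp add: M11_def vec_eq_iff forall_2)
  have star_closed: "sa_star ?M a \<in> sa_part ?M i" if "a \<in> sa_part ?M i" for a i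
    using that by (auto simp: M11_def)
  note mat_simps = M11_def vec_eq_iff forall_2 sum_2 matrix_matrix_mult_def mat_def algebra_simps
  show ?thesis
  proof (rule star_algebra.intro, goal_cases)
    case 1 show ?case by (rule vs)
  next
    case (9 i) then show ?case
      using md by (auto simp: module.subspace_def M11_def)
  next
    case (10 a)
    show ?case
    proof (intro bexI)
      show "a = vector [vector [a$1$1, 0], vector [0, a$2$2]] + vector [vector [0, a$1$2], vector [a$2$1, 0]]"
        by (simp add: vec_eq_iff forall_2)
    qed (simp_all add: M11_def)
  next
    case (12 i j a b) then show ?case
      by (auto simp: lt2 mat_simps)
  next
    case 13 show ?case
      using vs by (auto simp: Vector_Spaces.linear_iff mat_simps)
  next
    case (14 i) show ?case
      using star_star star_closed by (metis image_subset_iff subsetI subset_antisym image_eqI)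
  next
    case (15 a) show ?case by (rule star_star)
  next
    case (16 i j a b) then show ?case
      by (auto simp: lt2 mat_simps)
  qed (auto simp: mat_simps)
qed


section \<open>The free algebra and the identities of a superalgebra with superinvolution\<close>

instantiation list :: (type) monoid_add
begin

definition zero_list :: "'a list" where "zero_list = []"

definition plus_list :: "'a list \<Rightarrow> 'a list \<Rightarrow> 'a list" where "plus_list = (@)"

instance
  by standard (simp_all add: zero_list_def plus_list_def)

end

text \<open>\<open>Y0 i\<close>, \<open>Z0 i\<close>, \<open>Y1 i\<close>, \<open>Z1 i\<close> stand for the variables \<open>y\<close> and \<open>z\<close> with index
  \<open>i + 1\<close> and degree 0 or 1.\<close>

datatype var = Y0 nat | Z0 nat | Y1 nat | Z1 nat

text \<open>Words under concatenation form a monoid with the instance above, so the product that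
  \<^theory>\<open>HOL-Library.Poly_Mapping\<close> puts on finitely supported functions on words is that of the
  free associative algebra.\<close>

type_synonym 'f free_alg = "var list \<Rightarrow>\<^sub>0 'f"

definition indet :: "var \<Rightarrow> 'f::field free_alg" where
  "indet x = Poly_Mapping.single [x] 1"

definition free_scale :: "'f::field \<Rightarrow> 'f free_alg \<Rightarrow> 'f free_alg" where
  "free_scale r f = Poly_Mapping.map ((*) r) f"

lemma lookup_free_scale [simp]:
  "Poly_Mapping.lookup (free_scale r f) u = r * Poly_Mapping.lookup f u"
  by (simp add: free_scale_def Poly_Mapping.map.rep_eq when_def)

interpretation free: vector_space "free_scale :: 'f::field \<Rightarrow> 'f free_alg \<Rightarrow> 'f free_alg"
  by unfold_locales (auto intro!: poly_mapping_eqI simp: lookup_add algebra_simps)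

definition eval_word :: "('f, 'a) superalg \<Rightarrow> (var \<Rightarrow> 'a) \<Rightarrow> var list \<Rightarrow> 'a" where
  "eval_word A \<phi> u = foldr (\<lambda>x. sa_mult A (\<phi> x)) u (sa_one A)"

definition eval_poly :: "('f::field, 'a::comm_monoid_add) superalg \<Rightarrow> (var \<Rightarrow> 'a) \<Rightarrow> 'f free_alg \<Rightarrow> 'a" where
  "eval_poly A \<phi> f =
    (\<Sum>u\<in>Poly_Mapping.keys f. sa_scale A (Poly_Mapping.lookup f u) (eval_word A \<phi> u))"

definition admissible :: "('f, 'a::uminus) superalg \<Rightarrow> (var \<Rightarrow> 'a) \<Rightarrow> bool" where
  "admissible A \<phi> \<longleftrightarrow>
    (\<forall>i. \<phi> (Y0 i) \<in> sym_part A 0 \<and> \<phi> (Z0 i) \<in> skew_part A 0 \<and>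
         \<phi> (Y1 i) \<in> sym_part A 1 \<and> \<phi> (Z1 i) \<in> skew_part A 1)"

definition star_ids :: "('f::field, 'a::ab_group_add) superalg \<Rightarrow> 'f free_alg set" where
  "star_ids A = {f. \<forall>\<phi>. admissible A \<phi> \<longrightarrow> eval_poly A \<phi> f = 0}"

definition multilin :: "nat \<Rightarrow> 'f::field free_alg set" where
  "multilin n = free.span
    {prod_list (map (\<lambda>i. indet (w (\<sigma> i))) [0..<n]) | w \<sigma>.
      (\<forall>i<n. w i \<in> {Y0 i, Y1 i, Z0 i, Z1 i}) \<and> \<sigma> permutes {..<n}}"


section \<open>Codimensions and exponent\<close>

definition field_ring :: "'f::field ring" where
  "field_ring = \<lparr> carrier = UNIV, mult = (*), one = 1, zero = 0, add = (+) \<rparr>"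

text \<open>The quotient of \<open>V\<close> by \<open>W\<close> as a module record; its elements are the cosets. The fields
  \<open>mult\<close> and \<open>one\<close> belong to the record type only and play no role for a module.\<close>

definition quot_space ::
    "('f \<Rightarrow> 'v \<Rightarrow> 'v) \<Rightarrow> 'v::ab_group_add set \<Rightarrow> 'v set \<Rightarrow> ('f, 'v set) module" where
  "quot_space scl V W =
    \<lparr> carrier = {(\<lambda>w. v + w) ` W | v. v \<in> V},
      mult = undefined, one = undefined,
      zero = W,
      add = (\<lambda>X Y. {x + y | x y. x \<in> X \<and> y \<in> Y}),
      smult = (\<lambda>r X. {scl r x + w | x w. x \<in> X \<and> w \<in> W}) \<rparr>"

lemma field_field_ring: "field (field_ring :: 'f::field ring)"
proof -
  have "\<exists>y. x * y = 1" if "x \<noteq> 0" for x :: 'f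
    using that by (metis right_inverse)
  moreover have "\<exists>y. y + x = 0 \<and> x + y = 0" for x :: 'f
    by (metis add.left_inverse add.right_inverse)
  ultimately show ?thesis
    unfolding field_ring_def
    by unfold_locales (auto simp: Units_def algebra_simps)
qed

lemma vectorspace_quot_space:
  assumes "vector_space scl" and V: "module.subspace scl V"
    and W: "module.subspace scl W" and WV: "W \<subseteq> V"
  shows "vectorspace field_ring (quot_space scl V W)"
proof -
  interpret vs: vector_space scl by fact
  interpret K: field "field_ring :: 'a ring" by (rule field_field_ring)
  let ?Q = "quot_space scl V W"
  let ?c = "\<lambda>v. (\<lambda>w. v + w) ` W"
  note subs = vs.subspace_add[OF W] vs.subspace_diff[OF W] vs.subspace_scale[OF W] vs.subspace_0[OF W]
    vs.subspace_add[OF V] vs.subspace_neg[OF V] vs.subspace_scale[OF V] vs.subspace_0[OF V]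
  have car: "carrier ?Q = ?c ` V" by (auto simp: quot_space_def)
  have zero: "\<zero>\<^bsub>?Q\<^esub> = ?c 0" by (simp add: quot_space_def)
  have add: "?c a \<oplus>\<^bsub>?Q\<^esub> ?c b = ?c (a + b)" for a b
  proof (intro Set.set_eqI iffI)
    fix x assume "x \<in> ?c a \<oplus>\<^bsub>?Q\<^esub> ?c b"
    then obtain u v where "u \<in> W" "v \<in> W" "x = (a + u) + (b + v)"
      by (auto simp: quot_space_def)
    then show "x \<in> ?c (a + b)"
      using subs by (intro image_eqI[of _ _ "u + v"]) (simp_all add: algebra_simps)
  next
    fix x assume "x \<in> ?c (a + b)"
    then obtain u where u: "u \<in> W" "x = (a + u) + (b + 0)"
      by (auto simp: algebra_simps)
    moreover have "a + u \<in> ?c a" "b + 0 \<in> ?c b"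
      by (intro imageI u subs)+
    ultimately show "x \<in> ?c a \<oplus>\<^bsub>?Q\<^esub> ?c b"
      unfolding quot_space_def by auto
  qed
  have smult: "r \<odot>\<^bsub>?Q\<^esub> ?c a = ?c (scl r a)" for r a
  proof (intro Set.set_eqI iffI)
    fix x assume "x \<in> r \<odot>\<^bsub>?Q\<^esub> ?c a"
    then obtain u v where "u \<in> W" "v \<in> W" "x = scl r (a + u) + v"
      by (auto simp: quot_space_def)
    then show "x \<in> ?c (scl r a)"
      using subs by (intro image_eqI[of _ _ "scl r u + v"])
        (simp_all add: algebra_simps vs.scale_right_distrib)
  next
    fix x assume "x \<in> ?c (scl r a)"
    then obtain u where "u \<in> W" "x = scl r (a + 0) + u" by auto
    moreover have "a + 0 \<in> ?c a"
      using subs(4) by (rule imageI)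
    ultimately show "x \<in> r \<odot>\<^bsub>?Q\<^esub> ?c a"
      unfolding quot_space_def by auto
  qed
  interpret Q: abelian_group ?Q
  proof (rule abelian_groupI)
    fix x assume "x \<in> carrier ?Q"
    then obtain a where "a \<in> V" "x = ?c a" by (auto simp: car)
    then show "\<exists>y\<in>carrier ?Q. y \<oplus>\<^bsub>?Q\<^esub> x = \<zero>\<^bsub>?Q\<^esub>"
      using subs by (intro bexI[of _ "?c (- a)"]) (auto simp only: car add zero left_minus)
  next
    fix x y assume "x \<in> carrier ?Q" "y \<in> carrier ?Q"
    then obtain a b where ab: "a \<in> V" "b \<in> V" and xy: "x = ?c a" "y = ?c b" by (auto simp: car)
    show "x \<oplus>\<^bsub>?Q\<^esub> y \<in> carrier ?Q"
      unfolding xy add car using ab subs by (intro imageI) simp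
    show "x \<oplus>\<^bsub>?Q\<^esub> y = y \<oplus>\<^bsub>?Q\<^esub> x"
      unfolding xy add by (simp only: add.commute)
    fix z assume "z \<in> carrier ?Q"
    then obtain c where z: "z = ?c c" by (auto simp: car)
    show "x \<oplus>\<^bsub>?Q\<^esub> y \<oplus>\<^bsub>?Q\<^esub> z = x \<oplus>\<^bsub>?Q\<^esub> (y \<oplus>\<^bsub>?Q\<^esub> z)"
      unfolding xy z add by (simp only: add.assoc)
  next
    show "\<zero>\<^bsub>?Q\<^esub> \<in> carrier ?Q"
      unfolding zero car using subs by (intro imageI)
  next
    fix x assume "x \<in> carrier ?Q"
    then obtain a where x: "x = ?c a" by (auto simp: car)
    show "\<zero>\<^bsub>?Q\<^esub> \<oplus>\<^bsub>?Q\<^esub> x = x"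
      unfolding zero x add by simp
  qed
  have "Module.module field_ring ?Q"
  proof (rule moduleI[OF K.is_cring Q.abelian_group_axioms])
    fix r s x y assume "x \<in> carrier ?Q" "y \<in> carrier ?Q"
    then obtain a b where ab: "a \<in> V" "b \<in> V" and xy: "x = ?c a" "y = ?c b" by (auto simp: car)
    show "r \<odot>\<^bsub>?Q\<^esub> x \<in> carrier ?Q"
      unfolding xy smult car using ab subs by (intro imageI) simp
    show "(r \<oplus>\<^bsub>field_ring\<^esub> s) \<odot>\<^bsub>?Q\<^esub> x = r \<odot>\<^bsub>?Q\<^esub> x \<oplus>\<^bsub>?Q\<^esub> s \<odot>\<^bsub>?Q\<^esub> x"
      unfolding xy add smult by (simp add: field_ring_def vs.scale_left_distrib)
    show "r \<odot>\<^bsub>?Q\<^esub> (x \<oplus>\<^bsub>?Q\<^esub> y) = r \<odot>\<^bsub>?Q\<^esub> x \<oplus>\<^bsub>?Q\<^esub> r \<odot>\<^bsub>?Q\<^esub> y"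
      unfolding xy add smult by (simp add: vs.scale_right_distrib)
    show "(r \<otimes>\<^bsub>field_ring\<^esub> s) \<odot>\<^bsub>?Q\<^esub> x = r \<odot>\<^bsub>?Q\<^esub> (s \<odot>\<^bsub>?Q\<^esub> x)"
      unfolding xy smult by (simp add: field_ring_def)
    show "\<one>\<^bsub>field_ring\<^esub> \<odot>\<^bsub>?Q\<^esub> x = x"
      unfolding xy smult by (simp add: field_ring_def)
  qed
  then show ?thesis
    by (simp add: vectorspace_def K.field_axioms)
qed

lemma subspace_multilin_star_ids:
  assumes "star_algebra A"
  shows "free.subspace (multilin n \<inter> star_ids A)"
proof -
  interpret A: star_algebra A by fact
  interpret vs: vector_space "sa_scale A" by (rule A.vector_space)
  have sup: "eval_poly A \<phi> f =
      (\<Sum>u\<in>S. sa_scale A (Poly_Mapping.lookup f u) (eval_word A \<phi> u))"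
    if "finite S" "Poly_Mapping.keys f \<subseteq> S" for \<phi> f S
    unfolding eval_poly_def using that
    by (intro sum.mono_neutral_left) (auto simp: in_keys_iff)
  have add: "eval_poly A \<phi> (f + g) = eval_poly A \<phi> f + eval_poly A \<phi> g" for \<phi> f g
    using Poly_Mapping.keys_add[of f g]
    by (simp add: sup[of "Poly_Mapping.keys f \<union> Poly_Mapping.keys g"] lookup_add
        vs.scale_left_distrib sum.distrib)
  have scale: "eval_poly A \<phi> (free_scale r f) = sa_scale A r (eval_poly A \<phi> f)" for \<phi> r f
  proof -
    have "Poly_Mapping.keys (free_scale r f) \<subseteq> Poly_Mapping.keys f"
      by (auto simp: in_keys_iff)
    then show ?thesis
      by (simp add: sup[of "Poly_Mapping.keys f"] vs.scale_sum_right)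
  qed
  have "free.subspace (star_ids A)"
    by (rule free.subspaceI) (auto simp: star_ids_def add scale, simp add: eval_poly_def)
  then show ?thesis
    by (simp add: multilin_def free.subspace_inter)
qed

definition star_codim :: "('f::field, 'a::ab_group_add) superalg \<Rightarrow> nat \<Rightarrow> nat" where
  "star_codim A n =
    vectorspace.dim field_ring (quot_space free_scale (multilin n) (multilin n \<inter> star_ids A))"

definition star_exp :: "('f::field, 'a::ab_group_add) superalg \<Rightarrow> nat" where
  "star_exp A = (THE d. \<exists>C1 C2 t1 t2 :: real. C1 > 0 \<and>
    (\<forall>n\<ge>1. C1 * real n powr t1 * real d ^ n \<le> real (star_codim A n) \<and>
           real (star_codim A n) \<le> C2 * real n powr t2 * real d ^ n))"

end

theory Submission
  imports Defs "HOL-Real_Asymp.Real_Asymp"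
begin

text \<open>Each of the four spaces of homogeneous symmetric or skew elements of \<open>M\<^sub>1\<^sub>,\<^sub>1\<close> is a line, so a
  multilinear polynomial is an identity iff it vanishes when, for every choice of the kinds of the
  variables, these are replaced by the matrices \<open>1\<close>, \<open>e\<^sub>1\<^sub>1 - e\<^sub>2\<^sub>2\<close>, \<open>e\<^sub>2\<^sub>1\<close>, \<open>e\<^sub>1\<^sub>2\<close>. With
  \<open>p\<close> factors \<open>e\<^sub>2\<^sub>1\<close> and \<open>q\<close> factors \<open>e\<^sub>1\<^sub>2\<close> a product can only be nonzero if \<open>|p - q| \<le> 1\<close>. Writing
  \<open>j = p + q\<close>, some arrangement has a nonzero first row iff \<open>p = \<lfloor>j / 2\<rfloor>\<close> and a nonzero second row
  iff \<open>q = \<lfloor>j / 2\<rfloor>\<close>; the two row conditions are independent unless \<open>j = 0\<close>. Counting the kinds with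
  such \<open>p\<close> and \<open>q\<close> yields the formula. The growth rate follows from
  \<open>1 / (2 (j + 1)) \<le> (binomial(j, \<lfloor>j / 2\<rfloor>) / 2^j)\<^sup>2 \<le> 1 / (j + 1)\<close> and the Cauchy-Schwarz inequality.\<close>


section \<open>Dimensions of quotient spaces\<close>

lemma coset_ops:
  assumes "vector_space scl" and W: "module.subspace scl W"
  shows add_cosets: "(\<lambda>w. a + w) ` W \<oplus>\<^bsub>quot_space scl V W\<^esub> (\<lambda>w. b + w) ` W = (\<lambda>w. (a + b) + w) ` W"
    and smult_coset: "r \<odot>\<^bsub>quot_space scl V W\<^esub> (\<lambda>w. a + w) ` W = (\<lambda>w. scl r a + w) ` W"
proof -
  interpret vs: vector_space scl by fact
  note W0 = vs.subspace_0[OF W]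
  have "x \<in> (\<lambda>w. (a + b) + w) ` W"
    if "x \<in> (\<lambda>w. a + w) ` W \<oplus>\<^bsub>quot_space scl V W\<^esub> (\<lambda>w. b + w) ` W" for x
  proof -
    from that obtain u v where "u \<in> W" "v \<in> W" "x = (a + b) + (u + v)"
      by (auto simp: quot_space_def algebra_simps)
    then show ?thesis using vs.subspace_add[OF W] by blast
  qed
  moreover have "(a + b) + u \<in> (\<lambda>w. a + w) ` W \<oplus>\<^bsub>quot_space scl V W\<^esub> (\<lambda>w. b + w) ` W"
    if "u \<in> W" for u
  proof -
    have "(a + b) + u = (a + u) + (b + 0)" by (simp add: algebra_simps)
    moreover have "a + u \<in> (\<lambda>w. a + w) ` W" "b + 0 \<in> (\<lambda>w. b + w) ` W"
      using that W0 by blast+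
    ultimately show ?thesis
      unfolding quot_space_def ring_record_simps by blast
  qed
  ultimately show "(\<lambda>w. a + w) ` W \<oplus>\<^bsub>quot_space scl V W\<^esub> (\<lambda>w. b + w) ` W = (\<lambda>w. (a + b) + w) ` W"
    by blast
  have "x \<in> (\<lambda>w. scl r a + w) ` W" if "x \<in> r \<odot>\<^bsub>quot_space scl V W\<^esub> (\<lambda>w. a + w) ` W" for x
  proof -
    from that obtain u v where "u \<in> W" "v \<in> W" "x = scl r a + (scl r u + v)"
      by (auto simp: quot_space_def algebra_simps vs.scale_right_distrib)
    then show ?thesis using vs.subspace_add[OF W] vs.subspace_scale[OF W] by blast
  qed
  moreover have "scl r a + u \<in> r \<odot>\<^bsub>quot_space scl V W\<^esub> (\<lambda>w. a + w) ` W" if "u \<in> W" for u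
  proof -
    have "a \<in> (\<lambda>w. a + w) ` W" using W0 by (metis add_0_right image_eqI)
    then show ?thesis using that unfolding quot_space_def by auto
  qed
  ultimately show "r \<odot>\<^bsub>quot_space scl V W\<^esub> (\<lambda>w. a + w) ` W = (\<lambda>w. scl r a + w) ` W"
    by blast
qed

text \<open>The \<open>l i\<close> descend to the quotient, where together they separate points, and
  up to nonzero factors they are dual to the cosets of the \<open>v i\<close>; hence these cosets
  form a basis. Only nonvanishing is asked on the diagonal, so that signs never need
  normalising.\<close>

lemma dim_quot_space:
  fixes scl :: "'f::field \<Rightarrow> 'v::ab_group_add \<Rightarrow> 'v" and l :: "'i \<Rightarrow> 'v \<Rightarrow> 'f"
  assumes "vector_space scl" and V: "module.subspace scl V"
    and fin: "finite I" and v: "v ` I \<subseteq> V"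
    and lin: "\<And>i. i \<in> I \<Longrightarrow> Vector_Spaces.linear scl (*) (l i)"
    and orth: "\<And>i j. i \<in> I \<Longrightarrow> j \<in> I \<Longrightarrow> l i (v j) = 0 \<longleftrightarrow> i \<noteq> j"
    and W_iff: "\<And>x. x \<in> W \<longleftrightarrow> x \<in> V \<and> (\<forall>i\<in>I. l i x = 0)"
  shows "vectorspace.dim field_ring (quot_space scl V W) = card I"
proof -
  interpret vs: vector_space scl by fact
  have l_add: "l i (x + y) = l i x + l i y" and l_scale: "l i (scl r x) = r * l i x"
    and l_diff: "l i (x - y) = l i x - l i y" and l_0: "l i 0 = 0"
    and l_sum: "l i (sum g J) = (\<Sum>j\<in>J. l i (g j))" if "i \<in> I" for i x y r and g :: "'i \<Rightarrow> 'v" and J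
  proof -
    interpret Vector_Spaces.linear scl "(*)" "l i" by (rule lin[OF that])
    show "l i (x + y) = l i x + l i y" by (rule add)
    show "l i (scl r x) = r * l i x" by (rule scale)
    show "l i (x - y) = l i x - l i y" by (rule diff)
    show "l i 0 = 0" by (rule zero)
    show "l i (sum g J) = (\<Sum>j\<in>J. l i (g j))" by (rule sum)
  qed
  note V_sub = vs.subspace_add[OF V] vs.subspace_diff[OF V] vs.subspace_scale[OF V] vs.subspace_0[OF V]
  have W: "vs.subspace W"
    by (rule vs.subspaceI) (auto simp: W_iff l_add l_scale l_0 V_sub)
  have W0: "0 \<in> W" by (rule vs.subspace_0[OF W])
  let ?Q = "quot_space scl V W"
  let ?c = "\<lambda>x. (\<lambda>w. x + w) ` W"
  interpret Q: vectorspace "field_ring :: 'f ring" ?Q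
    by (rule vectorspace_quot_space) (use assms W in auto)
  have car: "carrier ?Q = ?c ` V" by (auto simp: quot_space_def)
  have zero: "\<zero>\<^bsub>?Q\<^esub> = ?c 0" by (simp add: quot_space_def)
  have K: "carrier (field_ring :: 'f ring) = UNIV" "\<zero>\<^bsub>field_ring :: 'f ring\<^esub> = 0"
    by (simp_all add: field_ring_def)
  have c_eq: "?c x = ?c y \<longleftrightarrow> x - y \<in> W" for x y
  proof
    assume "?c x = ?c y"
    then have "x \<in> ?c y" using W0 by (metis add_0_right image_eqI)
    then show "x - y \<in> W" by auto
  next
    assume xy: "x - y \<in> W"
    have "x + w \<in> ?c y" if "w \<in> W" for w
      using vs.subspace_add[OF W xy that] by (intro image_eqI[of _ _ "x - y + w"]) auto
    moreover have "y + w \<in> ?c x" if "w \<in> W" for w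
      using vs.subspace_diff[OF W that xy] by (intro image_eqI[of _ _ "w - (x - y)"]) auto
    ultimately show "?c x = ?c y" by blast
  qed
  define b where "b i = ?c (v i)" for i
  have b_inj: "inj_on b I"
  proof (rule inj_onI, rule ccontr)
    fix i j assume ij: "i \<in> I" "j \<in> I" "b i = b j" "i \<noteq> j"
    then have "l i (v i - v j) = 0" by (simp add: b_def c_eq W_iff)
    then show False using ij orth[of i j] orth[of i i] by (simp add: l_diff)
  qed
  have b_car: "b ` I \<subseteq> carrier ?Q" using v by (auto simp: b_def car)
  \<comment> \<open>Coefficients of \<open>Q.lincomb\<close> are functions of the basis vector, here
    of the coset \<open>b j\<close>, not of the index \<open>j\<close>.\<close>
  have lincomb: "Q.lincomb a (b ` J) = ?c (\<Sum>j\<in>J. scl (a (b j)) (v j))" if "J \<subseteq> I" for a J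
    using finite_subset[OF that fin] that
  proof (induction J rule: finite_induct)
    case empty
    then show ?case by (simp add: zero)
  next
    case (insert j J)
    have j: "j \<in> I" and J: "J \<subseteq> I" using insert.prems by auto
    have "b j \<notin> b ` J" using inj_on_image_mem_iff[OF b_inj j J] insert.hyps by blast
    moreover have "b ` J \<subseteq> carrier ?Q" "b j \<in> carrier ?Q" using b_car j J by blast+
    ultimately have "Q.lincomb a (insert (b j) (b ` J)) = a (b j) \<odot>\<^bsub>?Q\<^esub> b j \<oplus>\<^bsub>?Q\<^esub> Q.lincomb a (b ` J)"
      using insert.hyps by (intro Q.lincomb_insert2) (simp_all add: K)
    also have "\<dots> = ?c (scl (a (b j)) (v j) + (\<Sum>j\<in>J. scl (a (b j)) (v j)))"
      using insert by (simp add: b_def coset_ops[OF \<open>vector_space scl\<close> W])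
    finally show ?case using insert.hyps by simp
  qed
  have l_comb: "l i (\<Sum>j\<in>I. scl (a j) (v j)) = a i * l i (v i)" if "i \<in> I" for a i
  proof -
    have "l i (\<Sum>j\<in>I. scl (a j) (v j)) = (\<Sum>j\<in>I. if j = i then a i * l i (v i) else 0)"
      unfolding l_sum[OF that] by (rule sum.cong) (use that orth in \<open>auto simp: l_scale\<close>)
    then show ?thesis using that fin by simp
  qed
  have "Q.lin_indpt (b ` I)"
  proof (rule Q.finite_lin_indpt2)
    fix a assume "Q.lincomb a (b ` I) = \<zero>\<^bsub>?Q\<^esub>"
    then have "(\<Sum>j\<in>I. scl (a (b j)) (v j)) - 0 \<in> W"
      by (simp only: lincomb[OF order_refl] zero c_eq)
    then show "\<forall>x\<in>b ` I. a x = \<zero>\<^bsub>field_ring\<^esub>"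
      using orth by (auto simp: W_iff l_comb[of _ "\<lambda>j. a (b j)"] K)
  qed (use fin b_car in auto)
  moreover have "Q.span (b ` I) = carrier ?Q"
  proof
    show "Q.span (b ` I) \<subseteq> carrier ?Q" using b_car by (rule Q.span_is_subset2)
    show "carrier ?Q \<subseteq> Q.span (b ` I)"
    proof
      fix X assume "X \<in> carrier ?Q"
      then obtain x where x: "x \<in> V" "X = ?c x" by (auto simp: car)
      \<comment> \<open>Duality forces the coordinate of \<open>x\<close> along \<open>b i\<close>
        to be \<open>l i x / l i (v i)\<close>; injectivity of \<open>b\<close> recovers the index
        from the coset.\<close>
      define a where "a X = (let i = the_inv_into I b X in l i x / l i (v i))" for X
      have a: "a (b j) = l j x / l j (v j)" if "j \<in> I" for j
        using that by (simp add: a_def the_inv_into_f_f[OF b_inj])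
      let ?s = "\<Sum>j\<in>I. scl (a (b j)) (v j)"
      have "?s \<in> V" using v by (intro vs.subspace_sum[OF V] V_sub) auto
      moreover have "l i ?s = l i x" if "i \<in> I" for i
        using l_comb[OF that, of "\<lambda>j. a (b j)"] a[OF that] orth[OF that that] by simp
      ultimately have "x - ?s \<in> W"
        using x by (simp add: W_iff V_sub l_diff)
      then have "X = Q.lincomb a (b ` I)" by (simp add: lincomb[OF order_refl] c_eq x)
      then show "X \<in> Q.span (b ` I)" using fin by (auto simp: Q.span_def K)
    qed
  qed
  ultimately have "Q.basis (b ` I)" using b_car by (simp add: Q.basis_def)
  then have "Q.dim = card (b ` I)" using fin by (intro Q.dim_basis) auto
  then show ?thesis using b_inj by (simp add: card_image)
qed


section \<open>Central binomial coefficients\<close>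

text \<open>The probability that a simple random walk of \<open>j\<close> steps ends at 0 for even
  \<open>j\<close>, or at one given neighbour of 0 for odd \<open>j\<close>; it decays like
  \<open>1 / sqrt j\<close>.\<close>

definition mid :: "nat \<Rightarrow> real" where
  "mid j = real (j choose (j div 2)) / 2 ^ j"

lemma mid_nonneg: "0 \<le> mid j"
  by (simp add: mid_def)

lemma mid_0: "mid 0 = 1"
  by (simp add: mid_def)

text \<open>By Pascal's rule the middle entry of row \<open>2 * k + 2\<close> is the sum of the two
  equal middle entries of the row above, and the power of 2 doubles as well. This reduces odd
  indices to even ones.\<close>

lemma mid_odd: "mid (Suc (2 * k)) = mid (2 * Suc k)"
proof -
  have "Suc (2 * k) choose Suc k = Suc (2 * k) choose k"
    by (subst binomial_symmetric) auto
  then have "2 * Suc k choose Suc k = 2 * (Suc (2 * k) choose k)" by simp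
  then show ?thesis by (simp add: mid_def)
qed

lemma mid_even_Suc: "mid (2 * Suc k) = mid (2 * k) * (2 * k + 1) / (2 * k + 2)"
proof -
  have "Suc k * (2 * Suc k choose Suc k) = 2 * Suc k * (Suc (2 * k) choose k)"
    using Suc_times_binomial[of k "Suc (2 * k)"] by simp
  moreover have "Suc k * (Suc (2 * k) choose Suc k) = Suc (2 * k) * (2 * k choose k)"
    by (rule Suc_times_binomial)
  moreover have "Suc (2 * k) choose Suc k = Suc (2 * k) choose k"
    by (subst binomial_symmetric) auto
  ultimately have "Suc k * (2 * Suc k choose Suc k) = 2 * (Suc (2 * k) * (2 * k choose k))"
    by (metis mult.assoc)
  from this[THEN arg_cong[of _ _ real]]
  have "real (Suc k) * real (2 * Suc k choose Suc k) = 2 * (real (Suc (2 * k)) * real (2 * k choose k))"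
    by (simp only: of_nat_mult of_nat_numeral)
  then have "real (2 * Suc k choose Suc k) = 2 * (real (Suc (2 * k)) * real (2 * k choose k)) / real (Suc k)"
    by (simp add: eq_divide_eq mult.commute del: of_nat_Suc binomial_Suc_Suc)
  moreover have "mid (2 * Suc k) = real (2 * Suc k choose Suc k) / (4 * 2 ^ (2 * k))"
    by (simp add: mid_def del: binomial_Suc_Suc)
  moreover have "mid (2 * k) = real (2 * k choose k) / 2 ^ (2 * k)"
    by (simp add: mid_def)
  \<comment> \<open>The remaining computation as an identity in real variables, instantiated with
    \<open>t = k\<close>, \<open>x\<close> the central binomial coefficient and \<open>y\<close> the
    power of 2.\<close>
  moreover have "2 * ((1 + 2 * t) * x) / (1 + t) / (4 * y) = x / y * (2 * t + 1) / (2 * t + 2)"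
    if "t \<ge> 0" "y > 0" for t x y :: real
    using that by (simp add: divide_simps) (simp add: algebra_simps)
  note this[of "real k" "2 ^ (2 * k)" "real (2 * k choose k)"]
  ultimately show ?thesis by (simp add: add.commute del: binomial_Suc_Suc mult_Suc_right)
qed

text \<open>The left side decreases from 1: its successive ratios are \<open>(m^2 - 1) / m^2\<close>
  with \<open>m = 2 * k + 2\<close>.\<close>

lemma mid_even_upper: "(2 * real k + 1) * mid (2 * k) ^ 2 \<le> 1"
proof (induction k)
  case (Suc k)
  have "(2 * real (Suc k) + 1) * mid (2 * Suc k) ^ 2
      = (2 * real k + 1) * mid (2 * k) ^ 2 * ((2 * real k + 3) * (2 * real k + 1) / (2 * real k + 2) ^ 2)"
    unfolding mid_even_Suc by (simp add: power_mult_distrib power_divide power2_eq_square algebra_simps)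
  also have "\<dots> \<le> 1 * 1"
  proof (intro mult_mono Suc.IH)
    have "0 < (2 * real k + 2) ^ 2" by simp
    then show "(2 * real k + 3) * (2 * real k + 1) / (2 * real k + 2) ^ 2 \<le> 1"
      by (simp only: divide_le_eq_1_pos) (simp add: power2_eq_square algebra_simps)
  qed auto
  finally show ?case by simp
qed (simp add: mid_def)

text \<open>The right side increases from 1: its successive ratios are
  \<open>m^2 / (m^2 - 1)\<close> with \<open>m = 2 * k + 3\<close>. The start is index 2, since at
  index 0 the linear factor would vanish.\<close>

lemma mid_even_lower: "1 \<le> 4 * real (Suc k) * mid (2 * Suc k) ^ 2"
proof (induction k)
  case 0
  show ?case unfolding mid_even_Suc by (simp add: mid_def power2_eq_square)
next
  case (Suc k)
  have "0 < (2 * real k + 4) * (2 * real k + 2)" by simp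
  then have "1 \<le> (2 * real k + 3) ^ 2 / ((2 * real k + 4) * (2 * real k + 2))"
    by (simp only: le_divide_eq_1_pos) (simp add: power2_eq_square algebra_simps)
  then have "1 * 1 \<le> 4 * real (Suc k) * mid (2 * Suc k) ^ 2 * ((2 * real k + 3) ^ 2 / ((2 * real k + 4) * (2 * real k + 2)))"
    using Suc.IH by (intro mult_mono) auto
  also have "\<dots> = 4 * real (Suc (Suc k)) * mid (2 * Suc (Suc k)) ^ 2"
    unfolding mid_even_Suc[of "Suc k"]
    by (simp add: power_mult_distrib power_divide power2_eq_square divide_simps) (simp add: algebra_simps)
  finally show ?case by simp
qed

text \<open>Odd \<open>j = 2 * k + 1\<close> dictates the constant: there \<open>2 * (j + 1)\<close>
  is exactly the factor \<open>4 * (k + 1)\<close> of \<open>mid_even_lower\<close>. Positive even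
  \<open>j\<close> leaves some room.\<close>

lemma mid_lower: "1 / (2 * (real j + 1)) \<le> mid j ^ 2"
proof -
  consider "j = 0" | k where "j = 2 * Suc k" | k where "j = Suc (2 * k)"
    by (metis evenE mult_0_right not0_implies_Suc oddE Suc_eq_plus1)
  then show ?thesis
  proof cases
    case (2 k)
    have "1 / (2 * (real j + 1)) \<le> 1 / (4 * real (Suc k))"
      unfolding 2 by (intro divide_left_mono) auto
    also have "\<dots> \<le> mid j ^ 2"
      unfolding 2 using mid_even_lower[of k] by (simp only: divide_le_eq) (simp add: mult.commute)
    finally show ?thesis .
  next
    case (3 k)
    have "1 / (2 * (real j + 1)) = 1 / (4 * real (Suc k))" by (simp add: 3)
    also have "\<dots> \<le> mid j ^ 2"
      unfolding 3 mid_odd using mid_even_lower[of k] by (simp only: divide_le_eq) (simp add: mult.commute)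
    finally show ?thesis .
  qed (simp add: mid_0)
qed

lemma mid_upper: "mid j ^ 2 \<le> 1 / (real j + 1)"
proof (cases "even j")
  case True
  then obtain k where "j = 2 * k" by (rule evenE)
  then show ?thesis using mid_even_upper[of k] by (simp add: le_divide_eq mult.commute)
next
  case False
  then obtain k where k: "j = Suc (2 * k)" by (metis oddE Suc_eq_plus1)
  have "mid j ^ 2 \<le> 1 / (2 * real (Suc k) + 1)"
    unfolding k mid_odd using mid_even_upper[of "Suc k"] by (simp only: le_divide_eq) (simp add: mult.commute)
  also have "\<dots> \<le> 1 / (real j + 1)"
    unfolding k by (intro divide_left_mono) auto
  finally show ?thesis .
qed

text \<open>All \<open>mid j\<close> with \<open>j \<le> n\<close> share the lower bound
  \<open>1 / sqrt (2 * (n + 1))\<close>, and the binomial weights add up to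
  \<open>2 ^ n\<close>.\<close>

lemma sum_binomial_mid_lower: "2 ^ n / sqrt (2 * (real n + 1)) \<le> (\<Sum>j=0..n. real (n choose j) * mid j)"
proof -
  have "1 / sqrt (2 * (real n + 1)) \<le> mid j" if "j \<le> n" for j
  proof -
    have "1 / sqrt (2 * (real n + 1)) \<le> sqrt (1 / (2 * (real j + 1)))"
      using that by (simp add: real_sqrt_divide frac_le)
    also have "\<dots> \<le> mid j" by (rule real_le_lsqrt) (use mid_lower[of j] mid_nonneg[of j] in auto)
    finally show ?thesis .
  qed
  then have "(\<Sum>j=0..n. real (n choose j) * (1 / sqrt (2 * (real n + 1)))) \<le> (\<Sum>j=0..n. real (n choose j) * mid j)"
    by (intro sum_mono mult_left_mono) auto
  moreover have "(\<Sum>j=0..n. real (n choose j) * (1 / sqrt (2 * (real n + 1)))) = 2 ^ n / sqrt (2 * (real n + 1))"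
    using choose_row_sum[of n, THEN arg_cong[of _ _ real]]
    by (simp add: sum_distrib_right[symmetric] atMost_atLeast0 flip: sum_divide_distrib)
  ultimately show ?thesis by simp
qed

text \<open>A uniform bound fails because \<open>mid 0 = 1\<close>. Cauchy-Schwarz for the binomial
  weights replaces \<open>mid j\<close> by its square, at most \<open>1 / (j + 1)\<close>, and the
  weighted sum of these reciprocals is computed by absorption.\<close>

lemma sum_binomial_mid_upper: "(\<Sum>j=0..n. real (n choose j) * mid j) \<le> 2 ^ n * sqrt 2 / sqrt (real n + 1)"
proof -
  have row: "(\<Sum>j=0..n. real (n choose j)) = 2 ^ n"
    using choose_row_sum[of n, THEN arg_cong[of _ _ real]] by (simp add: atMost_atLeast0)
  have "(\<Sum>j=0..n. real (n choose j) / (real j + 1)) * (real n + 1)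
      = (\<Sum>j=0..n. real (Suc n choose Suc j))"
    unfolding sum_distrib_right
  proof (rule sum.cong)
    fix j
    have "real (Suc j) * real (Suc n choose Suc j) = real (Suc n) * real (n choose j)"
      unfolding of_nat_mult[symmetric] Suc_times_binomial ..
    then show "real (n choose j) / (real j + 1) * (real n + 1) = real (Suc n choose Suc j)"
      by (simp add: field_simps del: binomial_Suc_Suc)
  qed simp
  \<comment> \<open>The shifted sum is row \<open>n + 1\<close> of Pascal's triangle without its
    first entry.\<close>
  also have "\<dots> \<le> (\<Sum>j\<le>Suc n. real (Suc n choose j))"
    unfolding sum.atMost_Suc_shift by (simp add: atMost_atLeast0 del: binomial_Suc_Suc)
  also have "\<dots> = 2 ^ Suc n"
    using choose_row_sum[of "Suc n", THEN arg_cong[of _ _ real]] by simp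
  finally have har: "(\<Sum>j=0..n. real (n choose j) / (real j + 1)) \<le> 2 ^ Suc n / (real n + 1)"
    by (simp add: field_simps)
  \<comment> \<open>Each weight is split into two square roots, one for either factor of the
    inequality.\<close>
  have "(\<Sum>j=0..n. sqrt (real (n choose j)) * (sqrt (real (n choose j)) * mid j))\<^sup>2
    \<le> (\<Sum>j=0..n. (sqrt (real (n choose j)))\<^sup>2) * (\<Sum>j=0..n. (sqrt (real (n choose j)) * mid j)\<^sup>2)"
    by (rule Cauchy_Schwarz_ineq_sum)
  also have "(\<Sum>j=0..n. (sqrt (real (n choose j)) * mid j)\<^sup>2) \<le> (\<Sum>j=0..n. real (n choose j) / (real j + 1))"
  proof (rule sum_mono)
    fix j
    have "(sqrt (real (n choose j)) * mid j)\<^sup>2 = real (n choose j) * mid j ^ 2"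
      by (simp add: power_mult_distrib)
    also have "\<dots> \<le> real (n choose j) * (1 / (real j + 1))"
      by (intro mult_left_mono mid_upper) auto
    finally show "(sqrt (real (n choose j)) * mid j)\<^sup>2 \<le> real (n choose j) / (real j + 1)" by simp
  qed
  also note har
  finally have "(\<Sum>j=0..n. real (n choose j) * mid j)\<^sup>2 \<le> 2 ^ n * (2 ^ Suc n / (real n + 1))"
    by (simp add: row mult.assoc[symmetric])
  also have "\<dots> = (2 ^ n * sqrt 2 / sqrt (real n + 1))\<^sup>2"
    by (simp add: power_divide power_mult_distrib power2_eq_square)
  finally show ?thesis by (rule power2_le_imp_le) simp
qed

text \<open>If \<open>d > e\<close>, the exponential \<open>(d / e) ^ n\<close> outgrows every power
  of \<open>n\<close>, so the lower bound would eventually exceed the upper one.\<close>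

lemma growth_rate_unique:
  fixes d e :: nat and f :: "nat \<Rightarrow> real"
  assumes "C1 > 0" and "\<And>n. n \<ge> 1 \<Longrightarrow> C1 * real n powr s * real d ^ n \<le> f n"
    and "e > 0" and "\<And>n. n \<ge> 1 \<Longrightarrow> f n \<le> C2 * real n powr t * real e ^ n"
  shows "d \<le> e"
proof (rule ccontr)
  assume "\<not> d \<le> e"
  define q where "q = real d / real e"
  have q: "q > 1" using \<open>\<not> d \<le> e\<close> \<open>e > 0\<close> by (simp add: q_def)
  have "filterlim (\<lambda>n. real n powr (s - t) * q ^ n) at_top sequentially"
    using q by real_asymp
  then have "eventually (\<lambda>n. real n powr (s - t) * q ^ n > C2 / C1) sequentially"
    by (simp add: filterlim_at_top_dense)
  then obtain n where n: "n \<ge> 1" "real n powr (s - t) * q ^ n > C2 / C1"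
    using eventually_happens[OF eventually_conj[OF _ eventually_ge_at_top[of 1]]] by force
  have "C1 * real n powr s * real d ^ n \<le> C2 * real n powr t * real e ^ n"
    using assms(2,4)[OF n(1)] by linarith
  then have "C1 * (real n powr (s - t) * q ^ n) \<le> C2"
    using n(1) \<open>e > 0\<close> by (simp add: q_def powr_diff power_divide field_simps)
  then show False using n(2) \<open>C1 > 0\<close> by (simp add: field_simps)
qed


section \<open>Kinds of variables\<close>

datatype kind = Sym0 | Skew0 | Sym1 | Skew1

lemma UNIV_kind: "UNIV = {Sym0, Skew0, Sym1, Skew1}"
  by (auto intro: kind.exhaust)

instance kind :: finite
  by standard (simp add: UNIV_kind)

fun var_of :: "kind \<Rightarrow> nat \<Rightarrow> var" where
  "var_of Sym0 i = Y0 i"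
| "var_of Skew0 i = Z0 i"
| "var_of Sym1 i = Y1 i"
| "var_of Skew1 i = Z1 i"

fun kind_of :: "var \<Rightarrow> kind" where
  "kind_of (Y0 i) = Sym0"
| "kind_of (Z0 i) = Skew0"
| "kind_of (Y1 i) = Sym1"
| "kind_of (Z1 i) = Skew1"

fun idx :: "var \<Rightarrow> nat" where
  "idx (Y0 i) = i"
| "idx (Z0 i) = i"
| "idx (Y1 i) = i"
| "idx (Z1 i) = i"

lemma kind_of_var_of [simp]: "kind_of (var_of k i) = k" and idx_var_of [simp]: "idx (var_of k i) = i"
  by (cases k; simp)+

lemma var_of_kind_of: "x \<in> {Y0 i, Y1 i, Z0 i, Z1 i} \<Longrightarrow> var_of (kind_of x) i = x"
  by auto

lemma var_of_mem: "var_of k i \<in> {Y0 i, Y1 i, Z0 i, Z1 i}"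
  by (cases k) auto


section \<open>Counting lists of kinds\<close>

lemma card_kind_lists_Suc:
  fixes P :: "kind list \<Rightarrow> bool"
  shows
  "card {ks. length ks = Suc n \<and> P ks} = (\<Sum>k\<in>UNIV. card {ks. length ks = n \<and> P (k # ks)})"
proof -
  have "{ks. length ks = Suc n \<and> P ks} = (\<Union>k\<in>UNIV. (#) k ` {ks. length ks = n \<and> P (k # ks)})"
    by (auto simp: length_Suc_conv)
  also have "card \<dots> = (\<Sum>k\<in>UNIV. card ((#) k ` {ks :: kind list. length ks = n \<and> P (k # ks)}))"
  proof (rule card_UN_disjoint)
    have "finite {ks :: kind list. length ks = n \<and> P (k # ks)}" for k
      by (rule finite_subset[OF _ finite_lists_length_eq[of UNIV n]]) auto
    then show "\<forall>k\<in>UNIV. finite ((#) k ` {ks :: kind list. length ks = n \<and> P (k # ks)})"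
      by blast
  qed auto
  also have "\<dots> = (\<Sum>k\<in>UNIV. card {ks. length ks = n \<and> P (k # ks)})"
    by (simp add: card_image)
  finally show ?thesis .
qed

text \<open>Choose the \<open>p + q\<close> odd places, then the \<open>p\<close> of them holding
  \<open>Sym1\<close>; each other place has two even kinds. Multiplying by
  \<open>2 ^ (p + q)\<close> avoids the exponent \<open>n - (p + q)\<close>, which would be
  truncated for \<open>p + q > n\<close>.\<close>

lemma card_kind_lists_count:
  "card {ks. length ks = n \<and> count_list ks Sym1 = p \<and> count_list ks Skew1 = q} * 2 ^ (p + q)
   = (n choose (p + q)) * ((p + q) choose p) * 2 ^ n"
proof (induction n arbitrary: p q)
  case 0
  have "{ks. length ks = 0 \<and> count_list ks Sym1 = p \<and> count_list ks Skew1 = q} =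
      (if p + q = 0 then {[]} else {})"
    by auto
  then show ?case by (simp add: binomial_eq_0)
next
  case (Suc n)
  define N where "N p q = card {ks. length ks = n \<and> count_list ks Sym1 = p \<and> count_list ks Skew1 = q}" for p q
  have IH: "N p q * 2 ^ (p + q) = (n choose (p + q)) * ((p + q) choose p) * 2 ^ n" for p q
    unfolding N_def by (rule Suc.IH)
  \<comment> \<open>The head is one of the two even kinds, or it lowers \<open>p\<close> or
    \<open>q\<close> by one.\<close>
  have rec: "card {ks. length ks = Suc n \<and> count_list ks Sym1 = p \<and> count_list ks Skew1 = q}
    = 2 * N p q + (if p = 0 then 0 else N (p - 1) q) + (if q = 0 then 0 else N p (q - 1))"
    unfolding card_kind_lists_Suc by (cases p; cases q) (simp_all add: UNIV_kind N_def)
  show ?case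
  proof (cases p; cases q)
    fix p' q' assume pq: "p = Suc p'" "q = Suc q'"
    then show ?thesis unfolding rec
      using IH[of p q] IH[of p' q] IH[of p q'] by (simp add: algebra_simps)
  next
    fix p' assume pq: "p = Suc p'" "q = 0"
    then show ?thesis unfolding rec
      using IH[of p q] IH[of p' q] by (simp add: algebra_simps)
  next
    fix q' assume pq: "p = 0" "q = Suc q'"
    then show ?thesis unfolding rec
      using IH[of p q] IH[of p q'] by (simp add: algebra_simps)
  next
    assume pq: "p = 0" "q = 0"
    then show ?thesis unfolding rec using IH[of p q] by simp
  qed
qed

definition odd_count :: "kind list \<Rightarrow> nat" where
  "odd_count ks = count_list ks Sym1 + count_list ks Skew1"

lemma odd_count_le_length: "odd_count ks \<le> length ks"
  unfolding odd_count_def by (induction ks) auto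

text \<open>Group the lists by their number \<open>j\<close> of odd entries: \<open>P\<close> then
  fixes the count of \<open>Sym1\<close> to \<open>a j\<close> and that of \<open>Skew1\<close> to
  \<open>j - a j\<close>.\<close>

lemma card_kind_lists_partition:
  assumes P: "\<And>ks. P ks \<longleftrightarrow> count_list ks Sym1 = a (odd_count ks)"
    and a: "\<And>j. a j \<le> j"
  shows "real (card {ks. length ks = n \<and> P ks}) = 2 ^ n * (\<Sum>j=0..n. real (n choose j) * (real (j choose a j) / 2 ^ j))"
proof -
  let ?S = "\<lambda>j. {ks. length ks = n \<and> count_list ks Sym1 = a j \<and> count_list ks Skew1 = j - a j}"
  have fin: "finite (?S j)" for j
    by (rule finite_subset[OF _ finite_lists_length_eq[of UNIV n]]) auto
  have j: "j = odd_count ks" if "ks \<in> ?S j" for ks j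
    using that a[of j] by (auto simp: odd_count_def)
  have S: "{ks. length ks = n \<and> P ks} = (\<Union>j\<in>{0..n}. ?S j)"
  proof (intro equalityI subsetI)
    fix ks assume "ks \<in> {ks. length ks = n \<and> P ks}"
    then have "ks \<in> ?S (odd_count ks)" "odd_count ks \<in> {0..n}"
      using P odd_count_le_length[of ks] by (auto simp: odd_count_def)
    then show "ks \<in> (\<Union>j\<in>{0..n}. ?S j)" by blast
  next
    fix ks assume "ks \<in> (\<Union>j\<in>{0..n}. ?S j)"
    then obtain j where "ks \<in> ?S j" by blast
    with j[OF this] P show "ks \<in> {ks. length ks = n \<and> P ks}" by auto
  qed
  have "card {ks. length ks = n \<and> P ks} = (\<Sum>j=0..n. card (?S j))"
    unfolding S by (rule card_UN_disjoint) (use fin j in blast)+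
  then have "real (card {ks. length ks = n \<and> P ks}) = (\<Sum>j=0..n. real (card (?S j)))"
    by (simp only: of_nat_sum)
  moreover have "real (card (?S j)) = 2 ^ n * (real (n choose j) * (real (j choose a j) / 2 ^ j))" for j
    using card_kind_lists_count[of n "a j" "j - a j", THEN arg_cong[of _ _ real]] a[of j]
    by (simp add: field_simps)
  ultimately show ?thesis by (simp only: sum_distrib_left)
qed

text \<open>A pair \<open>(ks, r)\<close> is an index when some arrangement of the factors of kinds \<open>ks\<close> has a
  product with nonzero row \<open>r\<close>; without odd factors the two rows carry the same information.\<close>

definition indices :: "nat \<Rightarrow> (kind list \<times> 2) set" where
  "indices n = {(ks, r). length ks = n \<and>
     (if r = 1 then count_list ks Sym1 = odd_count ks div 2
      else count_list ks Skew1 = odd_count ks div 2 \<and> odd_count ks \<noteq> 0)}"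

lemma finite_indices: "finite (indices n)"
  by (rule finite_subset[OF _ finite_cartesian_product[OF finite_lists_length_eq[of UNIV n] finite]])
    (auto simp: indices_def)

text \<open>Both rows contribute the same sum, by symmetry of the binomial coefficients. The final
  \<open>- 1\<close> accounts for the \<open>2 ^ n\<close> lists without odd entries, which are
  counted for row 1 only.\<close>

lemma card_indices:
  "real (card (indices n)) = 2 ^ n * (2 * (\<Sum>j=0..n. real (n choose j) * (real (j choose (j div 2)) / 2 ^ j)) - 1)"
proof -
  let ?A = "{ks. length ks = n \<and> count_list ks Sym1 = odd_count ks div 2}"
  let ?B = "{ks. length ks = n \<and> count_list ks Skew1 = odd_count ks div 2}"
  let ?C = "{ks. length ks = n \<and> odd_count ks = 0}"
  have fin: "finite {ks :: kind list. length ks = n \<and> P ks}" for P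
    by (rule finite_subset[OF _ finite_lists_length_eq[of UNIV n]]) auto
  have CB: "?C \<subseteq> ?B" by (auto simp: odd_count_def)
  have "x \<in> indices n \<longleftrightarrow> x \<in> ?A \<times> {1} \<union> (?B - ?C) \<times> {2}" for x
    using exhaust_2[of "snd x"] by (cases x) (auto simp: indices_def)
  then have idx: "indices n = ?A \<times> {1} \<union> (?B - ?C) \<times> {2}" by blast
  have "card (indices n) = card ?A + (card ?B - card ?C)"
    unfolding idx using fin CB by (subst card_Un_disjoint) (auto simp: card_Diff_subset)
  moreover have "card ?C \<le> card ?B" using fin CB by (intro card_mono) auto
  ultimately have card_eq: "real (card (indices n)) = real (card ?A) + (real (card ?B) - real (card ?C))"
    by (simp add: of_nat_diff)
  have cardA: "real (card ?A) = 2 ^ n * (\<Sum>j=0..n. real (n choose j) * (real (j choose (j div 2)) / 2 ^ j))"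
    by (rule card_kind_lists_partition[where a = "\<lambda>j. j div 2"]) simp_all
  \<comment> \<open>This puts the row 2 condition into the form in terms of \<open>Sym1\<close> that
    \<open>card_kind_lists_partition\<close> expects.\<close>
  have half: "count_list ks Skew1 = odd_count ks div 2 \<longleftrightarrow> count_list ks Sym1 = odd_count ks - odd_count ks div 2" for ks
  proof -
    have "y = m \<longleftrightarrow> x = x + y - m" if "m \<le> x + y" for x y m :: nat
      using that by auto
    then show ?thesis unfolding odd_count_def by simp
  qed
  have cardB: "real (card ?B) = 2 ^ n * (\<Sum>j=0..n. real (n choose j) * (real (j choose (j - j div 2)) / 2 ^ j))"
    by (rule card_kind_lists_partition[where a = "\<lambda>j. j - j div 2"]) (rule half, simp)
  have cardC: "real (card ?C) = 2 ^ n"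
    using card_kind_lists_count[of n 0 0] by (simp add: odd_count_def)
  have sym: "(j choose (j - j div 2)) = (j choose (j div 2))" for j
    by (rule binomial_symmetric[symmetric]) simp
  show ?thesis unfolding card_eq cardA cardB cardC sym by (simp add: right_diff_distrib)
qed


section \<open>Evaluation of multilinear polynomials\<close>

lemma linear_eval_poly:
  assumes "star_algebra A"
  shows "Vector_Spaces.linear free_scale (sa_scale A) (eval_poly A \<phi>)"
proof -
  interpret A: star_algebra A by fact
  interpret vs: vector_space "sa_scale A" by (rule A.vector_space)
  \<comment> \<open>Summing over any finite superset of the keys lets different polynomials share
    one index set.\<close>
  have sup: "eval_poly A \<phi> f =
      (\<Sum>u\<in>S. sa_scale A (Poly_Mapping.lookup f u) (eval_word A \<phi> u))"
    if "finite S" "Poly_Mapping.keys f \<subseteq> S" for f S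
    unfolding eval_poly_def using that
    by (intro sum.mono_neutral_left) (auto simp: in_keys_iff)
  have "eval_poly A \<phi> (f + g) = eval_poly A \<phi> f + eval_poly A \<phi> g" for f g
    using Poly_Mapping.keys_add[of f g]
    by (simp add: sup[of "Poly_Mapping.keys f \<union> Poly_Mapping.keys g"] lookup_add
        vs.scale_left_distrib sum.distrib)
  moreover have "eval_poly A \<phi> (free_scale r f) = sa_scale A r (eval_poly A \<phi> f)" for r f
  proof -
    have "Poly_Mapping.keys (free_scale r f) \<subseteq> Poly_Mapping.keys f"
      by (auto simp: in_keys_iff)
    then show ?thesis
      by (simp add: sup[of "Poly_Mapping.keys f"] vs.scale_sum_right)
  qed
  ultimately show ?thesis
    by (simp add: Vector_Spaces.linear_iff A.vector_space free.vector_space_axioms)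
qed

lemma eval_poly_single:
  assumes "star_algebra A"
  shows "eval_poly A \<phi> (Poly_Mapping.single u 1) = eval_word A \<phi> u"
proof -
  interpret A: star_algebra A by fact
  interpret vs: vector_space "sa_scale A" by (rule A.vector_space)
  show ?thesis by (simp add: eval_poly_def)
qed

lemma prod_list_indet:
  "prod_list (map (\<lambda>i. indet (g i)) is) = (Poly_Mapping.single (map g is) 1 :: 'f::field free_alg)"
proof (induction "is")
  case Nil
  have "Poly_Mapping.single ([] :: var list) (1 :: 'f) = 1"
    unfolding zero_list_def[symmetric] by (rule single_one)
  then show ?case by simp
next
  case (Cons i "is")
  then show ?case by (simp add: indet_def mult_single plus_list_def)
qed

text \<open>The list \<open>ks\<close> is indexed by variables and not by positions, so the kinds
  read along the word are \<open>permute_list \<sigma> ks\<close>.\<close>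

definition mono_word :: "kind list \<Rightarrow> (nat \<Rightarrow> nat) \<Rightarrow> var list" where
  "mono_word ks \<sigma> = map (\<lambda>i. var_of (ks ! \<sigma> i) (\<sigma> i)) [0..<length ks]"

lemma multilin_eq:
  "multilin n = free.span {Poly_Mapping.single (mono_word ks \<sigma>) (1 :: 'f::field) | ks \<sigma>.
    length ks = n \<and> \<sigma> permutes {..<n}}"
proof -
  let ?G = "{prod_list (map (\<lambda>i. indet (w (\<sigma> i))) [0..<n]) :: 'f free_alg | w \<sigma>.
      (\<forall>i<n. w i \<in> {Y0 i, Y1 i, Z0 i, Z1 i}) \<and> \<sigma> permutes {..<n}}"
  let ?H = "{Poly_Mapping.single (mono_word ks \<sigma>) (1 :: 'f) | ks \<sigma>. length ks = n \<and> \<sigma> permutes {..<n}}"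
  have "prod_list (map (\<lambda>i. indet (w (\<sigma> i))) [0..<n]) \<in> ?H"
    if w: "\<forall>i<n. w i \<in> {Y0 i, Y1 i, Z0 i, Z1 i}" and \<sigma>: "\<sigma> permutes {..<n}" for w \<sigma>
  proof -
    let ?ks = "map (\<lambda>i. kind_of (w i)) [0..<n]"
    have "var_of (?ks ! \<sigma> i) (\<sigma> i) = w (\<sigma> i)" if "i < n" for i
    proof -
      have "\<sigma> i < n" using permutes_in_image[OF \<sigma>, of i] that by simp
      then show ?thesis using w var_of_kind_of[of "w (\<sigma> i)" "\<sigma> i"] by simp
    qed
    then have "map (\<lambda>i. w (\<sigma> i)) [0..<n] = mono_word ?ks \<sigma>"
      by (simp add: mono_word_def)
    then show ?thesis unfolding prod_list_indet using \<sigma> by force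
  qed
  moreover have "Poly_Mapping.single (mono_word ks \<sigma>) 1 \<in> ?G"
    if "length ks = n" "\<sigma> permutes {..<n}" for ks \<sigma>
    unfolding prod_list_indet using that var_of_mem
    by (intro CollectI exI[of _ "\<lambda>i. var_of (ks ! i) i"] exI[of _ \<sigma>]) (simp add: mono_word_def)
  ultimately have "?G = ?H" by blast
  then show ?thesis unfolding multilin_def by (rule arg_cong)
qed


section \<open>Substitution of scaled matrix units\<close>

fun unit_of :: "kind \<Rightarrow> 'f::field ^ 2 ^ 2" where
  "unit_of Sym0 = mat 1"
| "unit_of Skew0 = vector [vector [1, 0], vector [0, - 1]]"
| "unit_of Sym1 = vector [vector [0, 0], vector [1, 0]]"
| "unit_of Skew1 = vector [vector [0, 1], vector [0, 0]]"

definition word_mat :: "kind list \<Rightarrow> 'f::field ^ 2 ^ 2" where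
  "word_mat ks = foldr (\<lambda>k. (**) (unit_of k)) ks (mat 1)"

lemma word_mat_simps [simp]: "word_mat [] = mat 1" "word_mat (k # ks) = unit_of k ** word_mat ks"
  by (simp_all add: word_mat_def)

definition scaled_units :: "(var \<Rightarrow> 'f) \<Rightarrow> var \<Rightarrow> 'f::field ^ 2 ^ 2" where
  "scaled_units c x = sa_scale M11 (c x) (unit_of (kind_of x))"

lemma admissible_scaled_units: "admissible M11 (scaled_units c)"
  by (simp add: admissible_def scaled_units_def sym_part_def skew_part_def M11_def mat_def vec_eq_iff forall_2)

text \<open>Comparing entries of a matrix with those of its image under the superinvolution leaves
  one free entry for each kind.\<close>

lemma admissible_M11E:
  fixes \<phi> :: "var \<Rightarrow> 'f::field_char_0 ^ 2 ^ 2"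
  assumes "admissible M11 \<phi>"
  obtains c where "\<phi> = scaled_units c"
proof -
  \<comment> \<open>Characteristic zero enters here: for the odd kinds one off-diagonal entry equals
    its own negative.\<close>
  have self_neg: "a = 0" if "a = - a" for a :: 'f
    using that by (metis add_eq_0_iff mult_2 mult_eq_0_iff zero_neq_numeral)
  have "\<exists>r. \<phi> x = sa_scale M11 r (unit_of (kind_of x))" for x
  proof (cases x)
    case (Y0 i)
    then have X: "\<phi> x \<in> sym_part M11 0" using assms by (simp add: admissible_def)
    then have "sa_star M11 (\<phi> x) $ 1 $ 1 = \<phi> x $ 1 $ 1" by (simp add: sym_part_def)
    moreover have "\<phi> x \<in> sa_part M11 0" using X by (simp add: sym_part_def)
    ultimately have "\<phi> x = sa_scale M11 (\<phi> x $ 1 $ 1) (unit_of Sym0)"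
      by (simp add: M11_def mat_def vec_eq_iff forall_2)
    then show ?thesis unfolding Y0 kind_of.simps by (rule exI)
  next
    case (Z0 i)
    then have X: "\<phi> x \<in> skew_part M11 0" using assms by (simp add: admissible_def)
    then have "sa_star M11 (\<phi> x) $ 1 $ 1 = - \<phi> x $ 1 $ 1" by (simp add: skew_part_def)
    moreover have "\<phi> x \<in> sa_part M11 0" using X by (simp add: skew_part_def)
    ultimately have "\<phi> x = sa_scale M11 (\<phi> x $ 1 $ 1) (unit_of Skew0)"
      by (simp add: M11_def mat_def vec_eq_iff forall_2)
    then show ?thesis unfolding Z0 kind_of.simps by (rule exI)
  next
    case (Y1 i)
    then have X: "\<phi> x \<in> sym_part M11 1" using assms by (simp add: admissible_def)
    then have "sa_star M11 (\<phi> x) $ 1 $ 2 = \<phi> x $ 1 $ 2" by (simp add: sym_part_def)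
    moreover have "\<phi> x \<in> sa_part M11 1" using X by (simp add: sym_part_def)
    ultimately have "\<phi> x = sa_scale M11 (\<phi> x $ 2 $ 1) (unit_of Sym1)"
      using self_neg[of "\<phi> x $ 1 $ 2"] by (simp add: M11_def mat_def vec_eq_iff forall_2)
    then show ?thesis unfolding Y1 kind_of.simps by (rule exI)
  next
    case (Z1 i)
    then have X: "\<phi> x \<in> skew_part M11 1" using assms by (simp add: admissible_def)
    then have "sa_star M11 (\<phi> x) $ 2 $ 1 = - \<phi> x $ 2 $ 1" by (simp add: skew_part_def)
    moreover have "\<phi> x \<in> sa_part M11 1" using X by (simp add: skew_part_def)
    ultimately have "\<phi> x = sa_scale M11 (\<phi> x $ 1 $ 2) (unit_of Skew1)"
      using self_neg[of "\<phi> x $ 2 $ 1"] by (simp add: M11_def mat_def vec_eq_iff forall_2)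
    then show ?thesis unfolding Z1 kind_of.simps by (rule exI)
  qed
  then obtain c where "\<phi> x = sa_scale M11 (c x) (unit_of (kind_of x))" for x by metis
  then show thesis by (intro that[of c]) (simp add: scaled_units_def fun_eq_iff)
qed

lemma scale_M11: "sa_scale M11 r X $ i $ j = r * X $ i $ j"
  by (simp add: M11_def)

lemma eval_word_scaled_units:
  "eval_word M11 (scaled_units c) u = sa_scale M11 (prod_list (map c u)) (word_mat (map kind_of u))"
proof (induction u)
  case Nil
  then show ?case by (simp add: eval_word_def M11_def vec_eq_iff)
next
  case (Cons x u)
  then have "eval_word M11 (scaled_units c) (x # u) =
      sa_mult M11 (scaled_units c x) (sa_scale M11 (prod_list (map c u)) (word_mat (map kind_of u)))"
    by (simp add: eval_word_def)
  also have "\<dots> = sa_scale M11 (prod_list (map c (x # u))) (word_mat (map kind_of (x # u)))"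
    by (simp add: scaled_units_def M11_def vec_eq_iff matrix_matrix_mult_def sum_2 algebra_simps)
  finally show ?case .
qed

text \<open>Variables whose kind disagrees with \<open>ks\<close> are sent to 0, so this
  substitution isolates the component of a multilinear polynomial with kinds
  \<open>ks\<close>.\<close>

definition unit_subst :: "kind list \<Rightarrow> var \<Rightarrow> 'f::field ^ 2 ^ 2" where
  "unit_subst ks = scaled_units (\<lambda>x. of_bool (idx x < length ks \<and> kind_of x = ks ! idx x))"

lemma map_kind_of_mono_word:
  assumes "\<sigma> permutes {..<length ks}"
  shows "map kind_of (mono_word ks \<sigma>) = permute_list \<sigma> ks"
  by (simp add: mono_word_def permute_list_def)

lemma prod_list_mono_word:
  fixes c :: "var \<Rightarrow> 'f::field"
  assumes "\<sigma> permutes {..<length ks}"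
  shows "prod_list (map c (mono_word ks \<sigma>)) = (\<Prod>i<length ks. c (var_of (ks ! i) i))"
proof -
  have "prod_list (map c (mono_word ks \<sigma>)) = (\<Prod>i<length ks. c (var_of (ks ! \<sigma> i) (\<sigma> i)))"
    by (simp add: mono_word_def o_def prod.list_conv_set_nth atLeast0LessThan)
  also have "\<dots> = (\<Prod>i<length ks. c (var_of (ks ! i) i))"
    using prod.permute[OF assms, of "\<lambda>i. c (var_of (ks ! i) i)"] by (simp add: o_def)
  finally show ?thesis .
qed

lemma eval_mono_word:
  assumes "\<sigma> permutes {..<length ks}"
  shows "eval_word M11 (scaled_units c) (mono_word ks \<sigma>) =
    sa_scale M11 (\<Prod>i<length ks. c (var_of (ks ! i) i)) (word_mat (permute_list \<sigma> ks))"
  by (simp add: eval_word_scaled_units prod_list_mono_word[OF assms] map_kind_of_mono_word[OF assms])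

lemma eval_unit_subst_mono_word:
  assumes "\<sigma> permutes {..<length ks}" "length ks' = length ks"
  shows "eval_word M11 (unit_subst ks') (mono_word ks \<sigma>) =
    (if ks' = ks then word_mat (permute_list \<sigma> ks) else (0 :: 'f::field ^ 2 ^ 2))"
proof -
  have "(\<Prod>i<length ks. of_bool (i < length ks' \<and> ks ! i = ks' ! i)) = (of_bool (ks' = ks) :: 'f)"
  proof (cases "ks' = ks")
    case False
    then obtain i where "i < length ks" "ks ! i \<noteq> ks' ! i"
      using assms(2) by (metis nth_equalityI)
    then show ?thesis using False by (auto simp: prod_zero_iff)
  qed simp
  then show ?thesis
    by (simp add: unit_subst_def eval_mono_word[OF assms(1)]) (simp add: M11_def vec_eq_iff)
qed

text \<open>A multilinear polynomial is the sum of its components for the various kind lists. In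
  each component every variable occurs once, so the scalars factor out as one product. By linearity,
  monomials suffice.\<close>

lemma eval_scaled_units:
  assumes "f \<in> multilin n"
  shows "eval_poly M11 (scaled_units c) f =
    (\<Sum>ks | length ks = n. sa_scale M11 (\<Prod>i<n. c (var_of (ks ! i) i)) (eval_poly M11 (unit_subst ks) f))"
  using assms unfolding multilin_eq
proof (induction rule: free.span_induct_alt)
  case base
  interpret L: Vector_Spaces.linear free_scale "sa_scale M11" "eval_poly M11 \<phi>" for \<phi> :: "var \<Rightarrow> 'a ^ 2 ^ 2"
    by (rule linear_eval_poly[OF star_algebra_M11])
  show ?case by (simp add: L.zero)
next
  case (step r x y)
  interpret L: Vector_Spaces.linear free_scale "sa_scale M11" "eval_poly M11 \<phi>" for \<phi> :: "var \<Rightarrow> 'a ^ 2 ^ 2"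
    by (rule linear_eval_poly[OF star_algebra_M11])
  obtain ks \<sigma> where x: "x = Poly_Mapping.single (mono_word ks \<sigma>) 1" and ks: "length ks = n"
    and \<sigma>: "\<sigma> permutes {..<length ks}" using step.hyps by auto
  have fin: "finite {ks :: kind list. length ks = n}"
    using finite_lists_length_eq[of "UNIV :: kind set" n] by simp
  have eval_x: "eval_poly M11 \<phi> x = eval_word M11 \<phi> (mono_word ks \<sigma>)" for \<phi> :: "var \<Rightarrow> 'a ^ 2 ^ 2"
    unfolding x by (rule eval_poly_single[OF star_algebra_M11])
  have "(\<Sum>ls | length ls = n. sa_scale M11 (\<Prod>i<n. c (var_of (ls ! i) i)) (eval_poly M11 (unit_subst ls) x))
      = (\<Sum>ls | length ls = n. if ls = ks then eval_poly M11 (scaled_units c) x else 0)"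
    by (rule sum.cong)
      (simp_all add: eval_x eval_unit_subst_mono_word[OF \<sigma>] eval_mono_word[OF \<sigma>] ks)
  also have "\<dots> = eval_poly M11 (scaled_units c) x" using fin ks by simp
  finally have eq: "eval_poly M11 (scaled_units c) x =
    (\<Sum>ls | length ls = n. sa_scale M11 (\<Prod>i<n. c (var_of (ls ! i) i)) (eval_poly M11 (unit_subst ls) x))" ..
  show ?case
    by (simp add: L.add L.scale step.IH eq L.vs2.scale_right_distrib sum.distrib L.vs2.scale_sum_right mult.commute)
qed

text \<open>Finitely many substitutions test an identity: every admissible one scales units, and its
  value is a combination of those at the \<open>unit_subst ks\<close>, which are admissible
  themselves.\<close>

lemma multilin_star_ids_iff:
  fixes f :: "'f::field_char_0 free_alg"
  assumes "f \<in> multilin n"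
  shows "f \<in> star_ids (M11 :: ('f, 'f ^ 2 ^ 2) superalg) \<longleftrightarrow>
    (\<forall>ks. length ks = n \<longrightarrow> eval_poly M11 (unit_subst ks) f = (0 :: 'f ^ 2 ^ 2))"
proof
  assume "f \<in> star_ids (M11 :: ('f, 'f ^ 2 ^ 2) superalg)"
  then show "\<forall>ks. length ks = n \<longrightarrow> eval_poly M11 (unit_subst ks) f = (0 :: 'f ^ 2 ^ 2)"
    by (simp add: star_ids_def unit_subst_def admissible_scaled_units)
next
  interpret vs: vector_space "sa_scale (M11 :: ('f, 'f ^ 2 ^ 2) superalg)"
    by (rule star_algebra.vector_space[OF star_algebra_M11])
  assume "\<forall>ks. length ks = n \<longrightarrow> eval_poly M11 (unit_subst ks) f = (0 :: 'f ^ 2 ^ 2)"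
  then have "eval_poly M11 (scaled_units c) f = (0 :: 'f ^ 2 ^ 2)" for c
    by (simp add: eval_scaled_units[OF assms])
  then show "f \<in> star_ids (M11 :: ('f, 'f ^ 2 ^ 2) superalg)"
    unfolding star_ids_def by (auto elim: admissible_M11E)
qed

section \<open>Entries that can be nonzero in an evaluation\<close>

definition imbalance :: "kind list \<Rightarrow> int" where
  "imbalance ks = int (count_list ks Sym1) - int (count_list ks Skew1)"

lemma imbalance_simps [simp]:
  "imbalance [] = 0" "imbalance (Sym0 # ks) = imbalance ks" "imbalance (Skew0 # ks) = imbalance ks"
  "imbalance (Sym1 # ks) = imbalance ks + 1" "imbalance (Skew1 # ks) = imbalance ks - 1"
  by (simp_all add: imbalance_def)

text \<open>Matrices graded by giving the unit at place \<open>(i, j)\<close> degree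
  \<open>i - j\<close>: a product of kinds \<open>ks\<close> is homogeneous of degree
  \<open>imbalance ks\<close>. Without odd factors it is moreover 1 or -1 times the second diagonal
  unit plus the first. Both conditions are linear and depend on \<open>ks\<close> only through its
  counts.\<close>

definition shape :: "kind list \<Rightarrow> ('f::field ^ 2 ^ 2) set" where
  "shape ks = {X.
    (X $ 1 $ 1 \<noteq> 0 \<longrightarrow> imbalance ks = 0) \<and> (X $ 2 $ 2 \<noteq> 0 \<longrightarrow> imbalance ks = 0) \<and>
    (X $ 1 $ 2 \<noteq> 0 \<longrightarrow> imbalance ks = - 1) \<and> (X $ 2 $ 1 \<noteq> 0 \<longrightarrow> imbalance ks = 1) \<and>
    (odd_count ks = 0 \<longrightarrow> X $ 2 $ 2 = (- 1) ^ count_list ks Skew0 * X $ 1 $ 1)}"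

lemma unit_of_mult:
  "(unit_of Sym0 ** X) = X"
  "(unit_of Skew0 ** X) $ 1 = X $ 1" "(unit_of Skew0 ** X) $ 2 = - X $ 2"
  "(unit_of Sym1 ** X) $ 1 = 0" "(unit_of Sym1 ** X) $ 2 = X $ 1"
  "(unit_of Skew1 ** X) $ 1 = X $ 2" "(unit_of Skew1 ** X) $ 2 = 0"
  by (simp_all add: vec_eq_iff forall_2 matrix_matrix_mult_def sum_2 mat_def)

lemma word_mat_shape: "word_mat ks \<in> shape ks"
proof (induction ks)
  case Nil
  show ?case by (simp add: shape_def mat_def)
next
  case (Cons k ks)
  then show ?case
    by (cases k) (auto simp: shape_def odd_count_def unit_of_mult simp del: unit_of.simps)
qed

lemma shape_permute_list:
  assumes "\<sigma> permutes {..<length ks}"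
  shows "shape (permute_list \<sigma> ks) = shape ks"
  unfolding shape_def odd_count_def imbalance_def
  by (simp add: mset_permute_list[OF assms] flip: count_mset)

lemma shape_lincomb:
  assumes X: "X \<in> shape ks" and Y: "Y \<in> shape ks"
  shows "sa_scale M11 r X + Y \<in> shape ks"
proof -
  have nz: "X $ i $ j \<noteq> 0 \<or> Y $ i $ j \<noteq> 0" if "(sa_scale M11 r X + Y) $ i $ j \<noteq> 0" for i j
    using that by (auto simp: scale_M11)
  have "(sa_scale M11 r X + Y) $ 2 $ 2 = (- 1) ^ count_list ks Skew0 * (sa_scale M11 r X + Y) $ 1 $ 1"
    if "odd_count ks = 0"
  proof -
    have "X $ 2 $ 2 = (- 1) ^ count_list ks Skew0 * X $ 1 $ 1" "Y $ 2 $ 2 = (- 1) ^ count_list ks Skew0 * Y $ 1 $ 1"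
      using X Y that by (simp_all only: shape_def mem_Collect_eq simp_thms)
    then show ?thesis by (simp only: vector_add_component scale_M11 distrib_left mult.left_commute)
  qed
  then show ?thesis using X Y nz unfolding shape_def by blast
qed

text \<open>All arrangements of \<open>ks\<close> have products in \<open>shape ks\<close>, which is
  closed under linear combinations.\<close>

lemma eval_unit_subst_shape:
  assumes "f \<in> multilin (length ks)"
  shows "eval_poly M11 (unit_subst ks) f \<in> (shape ks :: ('f::field ^ 2 ^ 2) set)"
  using assms unfolding multilin_eq
proof (induction rule: free.span_induct_alt)
  case base
  show ?case by (simp add: eval_poly_def shape_def)
next
  case (step r x y)
  interpret L: Vector_Spaces.linear free_scale "sa_scale M11" "eval_poly M11 \<phi>" for \<phi> :: "var \<Rightarrow> 'f ^ 2 ^ 2"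
    by (rule linear_eval_poly[OF star_algebra_M11])
  obtain ls \<sigma> where x: "x = Poly_Mapping.single (mono_word ls \<sigma>) 1" and ls: "length ks = length ls"
    and \<sigma>: "\<sigma> permutes {..<length ls}" using step.hyps by auto
  have "eval_poly M11 (unit_subst ks) x = (if ks = ls then word_mat (permute_list \<sigma> ks) else 0 :: 'f ^ 2 ^ 2)"
    unfolding x by (auto simp add: eval_poly_single[OF star_algebra_M11] eval_unit_subst_mono_word[OF \<sigma> ls])
  moreover have "word_mat (permute_list \<sigma> ls) \<in> (shape ls :: ('f ^ 2 ^ 2) set)"
    using word_mat_shape shape_permute_list[OF \<sigma>] by blast
  moreover have "(0 :: 'f ^ 2 ^ 2) \<in> shape ks" by (simp add: shape_def)
  ultimately have "eval_poly M11 (unit_subst ks) x \<in> (shape ks :: ('f ^ 2 ^ 2) set)"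
    by (simp split: if_splits)
  then show ?case using step.IH by (simp only: L.add L.scale shape_lincomb)
qed

text \<open>In \<open>shape ks\<close> each row has at most one place for a nonzero entry; the sum
  reads it off without a case distinction on the parity of \<open>odd_count ks\<close>.\<close>

definition row_sum :: "2 \<Rightarrow> 'f::field ^ 2 ^ 2 \<Rightarrow> 'f" where
  "row_sum r X = X $ r $ 1 + X $ r $ 2"

lemma linear_row_sum_eval_poly:
  "Vector_Spaces.linear free_scale (*) (\<lambda>f. row_sum r (eval_poly M11 \<phi> f) :: 'f::field)"
proof -
  interpret L: Vector_Spaces.linear free_scale "sa_scale M11" "eval_poly M11 \<phi> :: 'f free_alg \<Rightarrow> 'f ^ 2 ^ 2"
    by (rule linear_eval_poly[OF star_algebra_M11])
  have "vector_space ((*) :: 'f \<Rightarrow> 'f \<Rightarrow> 'f)"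
    by unfold_locales (simp_all add: algebra_simps)
  moreover have "row_sum r (eval_poly M11 \<phi> (f + g)) = row_sum r (eval_poly M11 \<phi> f) + row_sum r (eval_poly M11 \<phi> g)" for f g
    by (simp add: L.add row_sum_def)
  moreover have "row_sum r (eval_poly M11 \<phi> (free_scale c f)) = c * row_sum r (eval_poly M11 \<phi> f)" for c f
    by (simp add: L.scale row_sum_def scale_M11 distrib_left)
  ultimately show ?thesis
    unfolding Vector_Spaces.linear_iff using free.vector_space_axioms by blast
qed

text \<open>Row 1 needs imbalance 0 or -1, which forces \<open>Sym1\<close> to occur
  \<open>odd_count ks div 2\<close> times; row 2 needs 0 or 1, which forces the same for
  \<open>Skew1\<close>. So every row that could be nonzero is tested, except row 2 without odd
  factors, where row 1 determines it.\<close>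

lemma shape_eq_0I:
  assumes X: "X \<in> shape ks" and rows: "\<And>r. (ks, r) \<in> indices n \<Longrightarrow> row_sum r X = 0" and "length ks = n"
  shows "X = 0"
proof -
  have r1: "X $ 1 $ 1 + X $ 1 $ 2 = 0" if "imbalance ks = 0 \<or> imbalance ks = - 1"
  proof -
    have "count_list ks Sym1 = odd_count ks div 2"
      using that unfolding imbalance_def odd_count_def by linarith
    then show ?thesis using rows[of 1] assms(3) by (simp add: indices_def row_sum_def)
  qed
  have r2: "X $ 2 $ 1 + X $ 2 $ 2 = 0" if "imbalance ks = 0 \<or> imbalance ks = 1" "odd_count ks \<noteq> 0"
  proof -
    have "count_list ks Skew1 = odd_count ks div 2"
      using that(1) unfolding imbalance_def odd_count_def by linarith
    then show ?thesis using rows[of 2] that(2) assms(3) by (simp add: indices_def row_sum_def)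
  qed
  have odd: "odd_count ks \<noteq> 0" if "imbalance ks \<noteq> 0"
    using that by (auto simp: imbalance_def odd_count_def)
  have "X $ 1 $ 1 = 0" "X $ 1 $ 2 = 0"
    using X r1 by (auto simp: shape_def)
  moreover have "X $ 2 $ 1 = 0" "X $ 2 $ 2 = 0"
    using X r2 odd \<open>X $ 1 $ 1 = 0\<close> by (auto simp: shape_def)
  ultimately show ?thesis by (simp add: vec_eq_iff forall_2)
qed

section \<open>Arrangements with a prescribed nonzero row\<close>

fun alternate :: "'a \<Rightarrow> 'a \<Rightarrow> nat \<Rightarrow> 'a list" where
  "alternate a b 0 = []"
| "alternate a b (Suc n) = a # alternate b a n"

lemma count_alternate:
  assumes "a \<noteq> b"
  shows "count_list (alternate a b n) x = (if x = a then n - n div 2 else if x = b then n div 2 else 0)"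
proof -
  \<comment> \<open>Each recursive step swaps the two letters, so both starting orders go through
    one induction.\<close>
  have "count_list (alternate a b n) x = (if x = a then n - n div 2 else if x = b then n div 2 else 0) \<and>
    count_list (alternate b a n) x = (if x = b then n - n div 2 else if x = a then n div 2 else 0)"
    using assms by (induction n) auto
  then show ?thesis ..
qed

text \<open>Even factors in front only change signs of rows. Alternating the two odd units keeps the
  product nonzero, and the leading one selects the row: \<open>Skew1\<close> row 1,
  \<open>Sym1\<close> row 2.\<close>

definition arrange :: "2 \<Rightarrow> kind list \<Rightarrow> kind list" where
  "arrange r ks = filter (\<lambda>k. k = Sym0 \<or> k = Skew0) ks @
    (if r = 1 then alternate Skew1 Sym1 (odd_count ks) else alternate Sym1 Skew1 (odd_count ks))"

text \<open>Membership in \<open>indices n\<close> gives the non-leading odd kind the smaller half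
  of the odd places, exactly what the alternating word uses.\<close>

lemma mset_arrange:
  assumes "(ks, r) \<in> indices n"
  shows "mset (arrange r ks) = mset ks"
proof (rule multiset_eqI)
  fix k
  have "count_list (filter P ks) k = (if P k then count_list ks k else 0)" for P
    by (induction ks) auto
  moreover have "count_list ks Sym1 = odd_count ks - count_list ks Skew1"
    "count_list ks Skew1 = odd_count ks - count_list ks Sym1"
    by (simp_all add: odd_count_def)
  then have "if r = 1
    then count_list ks Sym1 = odd_count ks div 2 \<and> count_list ks Skew1 = odd_count ks - odd_count ks div 2
    else count_list ks Skew1 = odd_count ks div 2 \<and> count_list ks Sym1 = odd_count ks - odd_count ks div 2"
    using assms unfolding indices_def by (metis (mono_tags, lifting) case_prodD mem_Collect_eq)
  ultimately show "count (mset (arrange r ks)) k = count (mset ks) k"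
    by (cases k; cases "r = 1") (simp_all add: count_mset arrange_def count_alternate)
qed

lemma row_sum_word_mat_Cons:
  "row_sum r (word_mat (Sym0 # ks)) = row_sum r (word_mat ks)"
  "row_sum r (word_mat (Skew0 # ks)) = (if r = 1 then 1 else - 1) * row_sum r (word_mat ks)"
  "row_sum r (word_mat (Sym1 # ks)) = (if r = 1 then 0 else row_sum 1 (word_mat ks))"
  "row_sum r (word_mat (Skew1 # ks)) = (if r = 1 then row_sum 2 (word_mat ks) else 0)"
  using exhaust_2[of r]
  by (auto simp: row_sum_def unit_of_mult simp del: unit_of.simps)

text \<open>Removing a leading \<open>Skew1\<close> turns row 1 into row 2 of a word led by
  \<open>Sym1\<close>, and conversely; both orders and both rows are therefore treated together.
  Length 0 is excluded, as both rows of the identity are nonzero.\<close>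

lemma row_sum_alternate:
  "(row_sum r (word_mat (alternate Skew1 Sym1 (Suc j))) :: 'f::field) = of_bool (r = 1)"
  "(row_sum r (word_mat (alternate Sym1 Skew1 (Suc j))) :: 'f) = of_bool (r \<noteq> 1)"
proof -
  have nil: "row_sum r (word_mat [] :: 'f ^ 2 ^ 2) = 1" for r
    using exhaust_2[of r] by (auto simp: row_sum_def mat_def)
  have "\<forall>r. (row_sum r (word_mat (alternate Skew1 Sym1 (Suc j))) :: 'f) = of_bool (r = 1) \<and>
    (row_sum r (word_mat (alternate Sym1 Skew1 (Suc j))) :: 'f) = of_bool (r \<noteq> 1)"
  proof (induction j)
    case 0
    show ?case by (simp add: row_sum_word_mat_Cons nil del: word_mat_simps)
  next
    case (Suc j)
    then show ?case
      unfolding alternate.simps(2)[of _ _ "Suc j"] row_sum_word_mat_Cons by simp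
  qed
  then show "(row_sum r (word_mat (alternate Skew1 Sym1 (Suc j))) :: 'f) = of_bool (r = 1)"
    "(row_sum r (word_mat (alternate Sym1 Skew1 (Suc j))) :: 'f) = of_bool (r \<noteq> 1)"
    by blast+
qed

lemma row_sum_even_append:
  assumes "set xs \<subseteq> {Sym0, Skew0}"
  shows "(row_sum r (word_mat (xs @ ks)) :: 'f::field) = 0 \<longleftrightarrow> (row_sum r (word_mat ks) :: 'f) = 0"
  using assms
proof (induction xs)
  case (Cons k xs)
  have "(if r = 1 then 1 else - 1 :: 'f) \<noteq> 0" by simp
  then show ?case using Cons by (auto simp: row_sum_word_mat_Cons simp del: word_mat_simps)
qed simp

lemma row_sum_arrange:
  assumes "(ks, r) \<in> indices n" "(ks, s) \<in> indices n"
  shows "(row_sum s (word_mat (arrange r ks)) :: 'f::field) = 0 \<longleftrightarrow> s \<noteq> r"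
proof -
  let ?odd = "if r = 1 then alternate Skew1 Sym1 (odd_count ks) else alternate Sym1 Skew1 (odd_count ks)"
  have "(row_sum s (word_mat (arrange r ks)) :: 'f) = 0 \<longleftrightarrow> (row_sum s (word_mat ?odd) :: 'f) = 0"
    unfolding arrange_def by (rule row_sum_even_append) auto
  also have "\<dots> \<longleftrightarrow> s \<noteq> r"
  proof (cases "odd_count ks")
    case 0
    \<comment> \<open>Without odd factors both row sums are nonzero, but only row 1 is an
      index.\<close>
    then have "r = 1" "s = 1" using assms by (auto simp: indices_def split: if_splits)
    then show ?thesis using 0 by (simp add: row_sum_def mat_def)
  next
    case (Suc j)
    have "(row_sum s (word_mat ?odd) :: 'f) = of_bool (if r = 1 then s = 1 else s \<noteq> 1)"
      unfolding Suc by (simp only: row_sum_alternate split: if_split) blast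
    then show ?thesis using exhaust_2[of r] exhaust_2[of s] by auto
  qed
  finally show ?thesis .
qed

text \<open>\<open>dim_quot_space\<close> applies to the row sums of evaluations and the monomials
  realising \<open>arrange\<close>. Different kind lists are separated by \<open>unit_subst\<close>,
  different rows by \<open>row_sum_arrange\<close>; \<open>shape_eq_0I\<close> shows that the
  functionals cut out the identities.\<close>

lemma star_codim_M11:
  "star_codim (M11 :: ('f::field_char_0, 'f ^ 2 ^ 2) superalg) n = card (indices n)"
proof -
  define l :: "kind list \<times> 2 \<Rightarrow> 'f free_alg \<Rightarrow> 'f"
    where "l = (\<lambda>(ks, r) f. row_sum r (eval_poly M11 (unit_subst ks) f))"
  have "\<exists>\<sigma>. \<sigma> permutes {..<length ks} \<and> permute_list \<sigma> ks = arrange r ks" if "(ks, r) \<in> indices n" for ks r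
    using mset_eq_permutation[OF mset_arrange[OF that]] by metis
  then obtain \<sigma> where \<sigma>: "\<And>ks r. (ks, r) \<in> indices n \<Longrightarrow> \<sigma> ks r permutes {..<length ks}"
    and perm: "\<And>ks r. (ks, r) \<in> indices n \<Longrightarrow> permute_list (\<sigma> ks r) ks = arrange r ks"
    by metis
  define v :: "kind list \<times> 2 \<Rightarrow> 'f free_alg"
    where "v = (\<lambda>(ks, r). Poly_Mapping.single (mono_word ks (\<sigma> ks r)) 1)"
  have len: "length ks = n" if "(ks, r) \<in> indices n" for ks r
    using that by (simp add: indices_def)
  show ?thesis unfolding star_codim_def
  proof (rule dim_quot_space[where l = l and v = v])
    show "vector_space (free_scale :: 'f \<Rightarrow> _)" by (rule free.vector_space_axioms)
    show "free.subspace (multilin n)" by (simp add: multilin_def)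
    show "finite (indices n)" by (rule finite_indices)
    show "v ` indices n \<subseteq> multilin n"
      using \<sigma> len unfolding multilin_eq by (force simp: v_def intro!: free.span_base)
    show "Vector_Spaces.linear free_scale (*) (l i)" if "i \<in> indices n" for i
      unfolding l_def case_prod_beta by (rule linear_row_sum_eval_poly)
    show "l i (v j) = 0 \<longleftrightarrow> i \<noteq> j" if ij: "i \<in> indices n" "j \<in> indices n" for i j
    proof -
      obtain ks r ls s where i: "i = (ks, r)" and j: "j = (ls, s)" by force
      have "l i (v j) = row_sum r (if ks = ls then word_mat (arrange s ls) else 0)"
        using ij \<sigma>[of ls s] perm[of ls s] len[of ls s] len[of ks r]
        by (simp add: i j l_def v_def eval_poly_single[OF star_algebra_M11] eval_unit_subst_mono_word)
      then show ?thesis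
        using ij row_sum_arrange[of ls s n r, where ?'f = 'f] by (auto simp: i j row_sum_def)
    qed
    show "f \<in> multilin n \<inter> star_ids (M11 :: ('f, 'f ^ 2 ^ 2) superalg) \<longleftrightarrow>
        f \<in> multilin n \<and> (\<forall>i\<in>indices n. l i f = 0)" for f
    proof -
      have "(\<forall>ks. length ks = n \<longrightarrow> eval_poly M11 (unit_subst ks) f = (0 :: 'f ^ 2 ^ 2)) \<longleftrightarrow>
          (\<forall>i\<in>indices n. l i f = 0)" if f: "f \<in> multilin n"
      proof
        assume eval_0: "\<forall>ks. length ks = n \<longrightarrow> eval_poly M11 (unit_subst ks) f = (0 :: 'f ^ 2 ^ 2)"
        show "\<forall>i\<in>indices n. l i f = 0"
        proof
          fix i assume "i \<in> indices n"
          moreover obtain ks r where "i = (ks, r)" by force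
          ultimately show "l i f = 0" using eval_0 len[of ks r] by (simp add: l_def row_sum_def)
        qed
      next
        assume l_0: "\<forall>i\<in>indices n. l i f = 0"
        show "\<forall>ks. length ks = n \<longrightarrow> eval_poly M11 (unit_subst ks) f = (0 :: 'f ^ 2 ^ 2)"
        proof (intro allI impI)
          fix ks :: "kind list" assume ks: "length ks = n"
          show "eval_poly M11 (unit_subst ks) f = (0 :: 'f ^ 2 ^ 2)"
          proof (rule shape_eq_0I[OF eval_unit_subst_shape _ ks])
            show "f \<in> multilin (length ks)" using f ks by simp
            show "row_sum r (eval_poly M11 (unit_subst ks) f :: 'f ^ 2 ^ 2) = 0" if "(ks, r) \<in> indices n" for r
              using bspec[OF l_0 that] by (simp add: l_def)
          qed
        qed
      qed
      then show ?thesis using multilin_star_ids_iff[of f n] by blast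
    qed
  qed
qed


section \<open>Codimension formula, asymptotics and exponent\<close>

theorem proposition4p4:
  shows "(\<forall>n\<ge>1. real (star_codim (M11 :: ('f::field_char_0, 'f ^ 2 ^ 2) superalg) n) =
            2 ^ n * (2 * (\<Sum>j=0..n. real (n choose j) * real (j choose (j div 2)) * (1 / 2 ^ j)) - 1))
       \<and> (\<exists>c C :: real. 0 < c \<and> c \<le> C \<and>
            (\<forall>n\<ge>1. c * (4 ^ n * real n powr (- 1 / 2))
                       \<le> real (star_codim (M11 :: ('f, 'f ^ 2 ^ 2) superalg) n)
                 \<and> real (star_codim (M11 :: ('f, 'f ^ 2 ^ 2) superalg) n)
                       \<le> C * (4 ^ n * real n powr (- 1 / 2))))
       \<and> star_exp (M11 :: ('f, 'f ^ 2 ^ 2) superalg) = 4"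
proof -
  define c where "c n = real (star_codim (M11 :: ('f, 'f ^ 2 ^ 2) superalg) n)" for n
  define S where "S n = (\<Sum>j=0..n. real (n choose j) * mid j)" for n
  have c_eq: "c n = 2 ^ n * (2 * S n - 1)" for n
    unfolding c_def S_def star_codim_M11 card_indices mid_def ..
  have sqrt_powr: "real n powr - (1 / 2) = 1 / sqrt (real n)" for n
    using powr_minus_divide[of "real n" "1 / 2"] by (simp add: powr_half_sqrt)
  have four: "(4 :: real) ^ n = 2 ^ n * 2 ^ n" for n
    by (simp flip: power_mult_distrib)
  have lower: "1 / 2 * (4 ^ n * real n powr (- 1 / 2)) \<le> c n" if "n \<ge> 1" for n
  proof -
    \<comment> \<open>For \<open>n \<ge> 1\<close>, \<open>2 * (n + 1)\<close> is at most
      \<open>4 * n\<close>; this is the origin of the constant 1/2.\<close>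
    have "sqrt (2 * (real n + 1)) \<le> sqrt (2 ^ 2 * real n)"
      using that by simp
    then have "sqrt (2 * (real n + 1)) \<le> 2 * sqrt (real n)"
      by (simp only: real_sqrt_mult real_sqrt_power[symmetric]) simp
    then have "2 ^ n / (2 * sqrt (real n)) \<le> 2 ^ n / sqrt (2 * (real n + 1))"
      using that by (intro divide_left_mono) auto
    also have "\<dots> \<le> S n" unfolding S_def by (rule sum_binomial_mid_lower)
    finally have "2 ^ n * (2 ^ n / (2 * sqrt (real n))) \<le> 2 ^ n * S n"
      by (rule mult_left_mono) simp
    also have "\<dots> \<le> c n"
    proof -
      \<comment> \<open>The term \<open>j = 0\<close> alone gives \<open>S n \<ge> 1\<close>, so
        \<open>2 * S n - 1\<close> is at least \<open>S n\<close>.\<close>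
      have "(\<Sum>j\<in>{0}. real (n choose j) * mid j) \<le> S n"
        unfolding S_def by (rule sum_mono2) (auto simp: mid_nonneg)
      then show ?thesis by (simp add: c_eq mid_0)
    qed
    finally show ?thesis by (simp add: sqrt_powr four mult.assoc)
  qed
  have upper: "c n \<le> 4 * (4 ^ n * real n powr (- 1 / 2))" if "n \<ge> 1" for n
  proof -
    have "c n \<le> 2 ^ n * (2 * S n)" by (simp add: c_eq)
    also have "S n \<le> 2 ^ n * sqrt 2 / sqrt (real n + 1)"
      unfolding S_def by (rule sum_binomial_mid_upper)
    \<comment> \<open>Rounding \<open>sqrt 2\<close> up to 2 produces, with the factor 2 of the
      formula, the constant 4.\<close>
    also have "\<dots> \<le> 2 ^ n * 2 / sqrt (real n)"
      using that by (intro frac_le mult_left_mono) (auto intro: real_le_lsqrt)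
    finally show ?thesis by (simp add: sqrt_powr four mult_ac)
  qed
  have low4: "1 / 2 * real n powr (- 1 / 2) * real 4 ^ n \<le> c n" if "n \<ge> 1" for n
    using lower[OF that] by (simp add: mult.assoc mult.commute)
  have up4: "c n \<le> 4 * real n powr (- 1 / 2) * real 4 ^ n" if "n \<ge> 1" for n
    using upper[OF that] by (simp add: mult.assoc mult.commute)
  have "star_exp (M11 :: ('f, 'f ^ 2 ^ 2) superalg) = 4"
    unfolding star_exp_def c_def[symmetric]
  proof (rule the_equality)
    show "\<exists>C1 C2 t1 t2 :: real. C1 > 0 \<and> (\<forall>n\<ge>1. C1 * real n powr t1 * real 4 ^ n \<le> c n \<and>
        c n \<le> C2 * real n powr t2 * real 4 ^ n)"
      by (rule exI[of _ "1 / 2"], rule exI[of _ 4], rule exI[of _ "- 1 / 2"], rule exI[of _ "- 1 / 2"])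
        (use low4 up4 in auto)
    fix d assume "\<exists>C1 C2 t1 t2 :: real. C1 > 0 \<and> (\<forall>n\<ge>1. C1 * real n powr t1 * real d ^ n \<le> c n \<and>
        c n \<le> C2 * real n powr t2 * real d ^ n)"
    then obtain C1 C2 t1 t2 where "C1 > 0"
      and d_lower: "\<And>n. n \<ge> 1 \<Longrightarrow> C1 * real n powr t1 * real d ^ n \<le> c n"
      and d_upper: "\<And>n. n \<ge> 1 \<Longrightarrow> c n \<le> C2 * real n powr t2 * real d ^ n" by blast
    \<comment> \<open>For \<open>d = 0\<close> the upper bound at \<open>n = 1\<close> would be 0,
      while the codimension there is positive.\<close>
    have "d > 0"
    proof (rule ccontr)
      assume "\<not> d > 0"
      then show False using lower[of 1] d_upper[of 1] by simp
    qed
    have "d \<le> 4" by (rule growth_rate_unique[OF \<open>C1 > 0\<close> d_lower _ up4]) auto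
    moreover have "4 \<le> d" by (rule growth_rate_unique[OF _ low4 \<open>d > 0\<close> d_upper]) auto
    ultimately show "d = 4" by simp
  qed
  moreover have "\<exists>c' C :: real. 0 < c' \<and> c' \<le> C \<and>
      (\<forall>n\<ge>1. c' * (4 ^ n * real n powr (- 1 / 2)) \<le> c n \<and> c n \<le> C * (4 ^ n * real n powr (- 1 / 2)))"
    by (rule exI[of _ "1 / 2"], rule exI[of _ 4]) (use lower upper in auto)
  ultimately show ?thesis
    using c_eq unfolding c_def S_def mid_def by simp
qed

end
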